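(* There is a hereditary family of graphs $\mathcal{F}$ such that every $n$-vertex graph $G\in\mathcal{F}$ satisfies $\mathrm{sep}_V(G) \le \frac{n}{\log n}(\log\log n)^2$, yet there is no $C>0$ such that every $n$-vertex graph in $\mathcal{F}$ has at most $Cn$ edges.
   Context: Graphs are finite, simple and undirected; $\log$ denotes $\log_2$. A family of graphs is hereditary if it is closed under taking induced subgraphs. A vertex separator in a graph $G=(V,E)$ is a set of vertices whose removal disconnects $G$ into two (not necessarily connected) subgraphs, each on at most $\frac23|V|$ vertices; that is, a set $S\subseteq V$ such that $V\setminus S$ can be partitioned into two sets $A,B$ with $|A|,|B|\le\frac23|V|$ and no edge of $G$ between $A$ and $B$. $\mathrm{sep}_V(G)$ is the minimum cardinality of a vertex separator in $G$.
   Formalization: The separator bound is imposed only for n ≥ 4: at n = 1 it is undefined, at n = 2 it is 0 while sep_V(K_2) = 1, and at n = 3 it is below 1, which would force the family to consist of matchings. *)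

theory Defs
  imports Complex_Main
begin

text \<open>A graph is a pair of a vertex set and a set of edges, each edge being a two-element
  set of vertices.\<close>

type_synonym 'a graph = "'a set \<times> 'a set set"

abbreviation verts :: "'a graph \<Rightarrow> 'a set" where
  "verts G \<equiv> fst G"

abbreviation edges :: "'a graph \<Rightarrow> 'a set set" where
  "edges G \<equiv> snd G"

definition finite_simple_graph :: "'a graph \<Rightarrow> bool" where
  "finite_simple_graph G \<longleftrightarrow>
     finite (verts G) \<and> (\<forall>e\<in>edges G. e \<subseteq> verts G \<and> card e = 2)"

definition induced_subgraph :: "'a graph \<Rightarrow> 'a set \<Rightarrow> 'a graph" where
  "induced_subgraph G W = (W, {e \<in> edges G. e \<subseteq> W})"

definition hereditary :: "'a graph set \<Rightarrow> bool" where
  "hereditary F \<longleftrightarrow> (\<forall>G\<in>F. \<forall>W\<subseteq>verts G. induced_subgraph G W \<in> F)"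

text \<open>The two sides \<open>A\<close> and \<open>B\<close> may be empty. In particular every set of at least
  one third of the vertices is a separator, so complete graphs have separators as well.\<close>

definition vertex_separator :: "'a graph \<Rightarrow> 'a set \<Rightarrow> bool" where
  "vertex_separator G S \<longleftrightarrow>
     S \<subseteq> verts G \<and>
     (\<exists>A B. A \<union> B = verts G - S \<and> A \<inter> B = {} \<and>
        real (card A) \<le> 2 / 3 * real (card (verts G)) \<and>
        real (card B) \<le> 2 / 3 * real (card (verts G)) \<and>
        (\<forall>a\<in>A. \<forall>b\<in>B. {a, b} \<notin> edges G))"

definition sep_V :: "'a graph \<Rightarrow> nat" where
  "sep_V G = (LEAST k. \<exists>S. vertex_separator G S \<and> card S = k)"

text \<open>The separator bound \<open>(n / log n) (log log n)\<^sup>2\<close> is meant for \<open>n \<ge> 4\<close>. It is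
  undefined or vanishes for \<open>n \<le> 2\<close>, and for \<open>n = 3\<close> it is less than \<open>1\<close>, so that a
  hereditary family obeying it there contains no connected graph on three vertices and
  consists of matchings only.\<close>

definition sep_bound :: "nat \<Rightarrow> real" where
  "sep_bound n = real n / log 2 (real n) * (log 2 (log 2 (real n)))\<^sup>2"

end

theory Submission
  imports Defs "HOL-Library.Nat_Bijection" "HOL-Analysis.Convex"
begin

text \<open>The dense graphs are induced subgraphs, of large average but bounded maximum degree \<open>\<Delta>\<close>, of
  the hypercube \<open>Q\<^sub>d\<close>. A random vertex set of density \<open>\<kappa> / d\<close> spans average degree about \<open>\<kappa>\<close>. A
  closed walk of \<open>Q\<^sub>d\<close> uses every direction an even number of times, so there are only about
  \<open>(2 j d)\<^sup>j\<close> closed walks of length \<open>2 j\<close> at a vertex, and deleting a few vertices leaves no cycle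
  of length up to a fixed power of \<open>d\<close>.

  Let \<open>W\<close> be a set of \<open>m\<close> vertices and \<open>x = log m\<close>. If \<open>x\<close> is below a small power of \<open>d\<close>, region
  growing removes \<open>m / x\<close> vertices and leaves pieces of radius less than \<open>x\<^sup>2\<close>, which are trees because
  of the girth, and a centroid finishes. If \<open>x\<close> is larger, then \<open>log d\<close> is \<open>O(log x)\<close>, and since there
  are at most \<open>(d + 1)\<^sup>D\<close> points of \<open>Q\<^sub>d\<close> within distance \<open>D\<close>, a typical pair in \<open>W\<close> has Hamming
  distance of order \<open>x / log x\<close>. The \<open>d\<close> coordinate cuts share at most \<open>\<Delta> m\<close> edges, so one of
  them has edge-to-smaller-side ratio \<open>O(\<Delta> log x / x)\<close>, and iterating such cuts gives a balanced
  separator of size \<open>O(\<Delta> m log x / x)\<close>. With \<open>log x\<close> large compared to \<open>\<Delta>\<close> this is at most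
  \<open>m (log x)\<^sup>2 / x\<close>. Tiny \<open>m\<close> are covered by the separator of size \<open>\<lceil>m / 3\<rceil>\<close>.\<close>

section \<open>Balanced separators\<close>

text \<open>\<open>E\<close> lives on the whole type and the vertex set is a separate argument, so
  passing to an induced subgraph changes only \<open>W\<close>. The bounds of two thirds are cleared
  of fractions.\<close>

definition balanced_sep :: "('a \<Rightarrow> 'a \<Rightarrow> bool) \<Rightarrow> 'a set \<Rightarrow> 'a set \<Rightarrow> bool" where
  "balanced_sep E W S \<longleftrightarrow> S \<subseteq> W \<and>
     (\<exists>A B. A \<union> B = W - S \<and> A \<inter> B = {} \<and> 3 * card A \<le> 2 * card W \<and> 3 * card B \<le> 2 * card W \<and>
        (\<forall>a\<in>A. \<forall>b\<in>B. \<not> E a b))"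

lemma balanced_sepI:
  assumes "S \<subseteq> W" "A \<union> B = W - S" "A \<inter> B = {}" "3 * card A \<le> 2 * card W" "3 * card B \<le> 2 * card W"
    and "\<And>a b. a \<in> A \<Longrightarrow> b \<in> B \<Longrightarrow> \<not> E a b"
  shows "balanced_sep E W S"
  unfolding balanced_sep_def
  by (rule conjI, rule assms(1), rule exI[of _ A], rule exI[of _ B]) (use assms(2-) in simp)

text \<open>Deleting a third of the vertices, rounded up, leaves so few that one side can take them
  all.\<close>

lemma balanced_sep_third:
  assumes "finite W"
  shows "\<exists>S. balanced_sep E W S \<and> card S = (card W + 2) div 3"
proof -
  have "(card W + 2) div 3 \<le> card W" by linarith
  then obtain S where S: "S \<subseteq> W" "card S = (card W + 2) div 3"
    by (meson obtain_subset_with_card_n)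
  have "card (W - S) = card W - card S"
    using S assms by (simp add: card_Diff_subset finite_subset)
  then have "3 * card (W - S) \<le> 2 * card W" using S(2) by linarith
  then have "balanced_sep E W S"
    using S(1) by (intro balanced_sepI[of S W "W - S" "{}"]) auto
  with S(2) show ?thesis by blast
qed

text \<open>Keep cutting the smaller side off the remainder until a third of \<open>W\<close> is
  removed. Each piece is at most half of the remainder, so the total stays within two thirds, and
  the separator of each cut is charged to its piece.\<close>

lemma balanced_sep_iterate:
  fixes \<epsilon> :: real
  assumes fin: "finite W"
    and cut: "\<And>U. U \<subseteq> W \<Longrightarrow> 2 * card W < 3 * card U \<Longrightarrow>
      \<exists>A S. A \<subseteq> U \<and> A \<noteq> {} \<and> 2 * card A \<le> card U \<and> S \<subseteq> A \<and> real (card S) \<le> \<epsilon> * real (card A) \<and>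
        (\<forall>a\<in>A - S. \<forall>b\<in>U - A. \<not> E a b)"
    and sym: "\<And>a b. E a b \<Longrightarrow> E b a" and "\<epsilon> \<ge> 0"
  shows "\<exists>S. balanced_sep E W S \<and> real (card S) \<le> \<epsilon> * real (card W)"
proof -
  \<comment> \<open>\<open>T\<close> is the union of the pieces cut off so far and \<open>S\<close>
    the separator vertices in it; a largest such \<open>T\<close> replaces the iteration.\<close>
  define P where "P T S \<longleftrightarrow> T \<subseteq> W \<and> S \<subseteq> T \<and> real (card S) \<le> \<epsilon> * real (card T) \<and>
    3 * card T \<le> 2 * card W \<and> (\<forall>a\<in>T - S. \<forall>b\<in>W - T. \<not> E a b)" for T S
  have "\<exists>S. P {} S" by (rule exI[of _ "{}"]) (simp add: P_def)
  moreover have "\<forall>T. (\<exists>S. P T S) \<longrightarrow> card T < Suc (card W)"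
    using fin by (auto simp: P_def less_Suc_eq_le intro: card_mono)
  ultimately have "\<exists>T. (\<exists>S. P T S) \<and> (\<forall>T'. (\<exists>S. P T' S) \<longrightarrow> card T' \<le> card T)"
    by (rule ex_has_greatest_nat[of "\<lambda>T. \<exists>S. P T S"])
  then obtain T where T: "\<exists>S. P T S" and max: "\<And>T' S. P T' S \<Longrightarrow> card T' \<le> card T"
    by blast
  from T obtain S where S: "P T S" by blast
  have TW: "T \<subseteq> W" and ST: "S \<subseteq> T" using S by (auto simp: P_def)
  have finT: "finite T" using TW fin finite_subset by auto
  have cWT: "card (W - T) = card W - card T" using TW finT by (simp add: card_Diff_subset)
  have cTW: "card T \<le> card W" using TW fin by (simp add: card_mono)
  have large: "card W \<le> 3 * card T"
  proof (rule ccontr)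
    assume small: "\<not> card W \<le> 3 * card T"
    then have "2 * card W < 3 * card (W - T)" using cWT by linarith
    then obtain A S' where A: "A \<subseteq> W - T" "A \<noteq> {}" "2 * card A \<le> card (W - T)" "S' \<subseteq> A"
      "real (card S') \<le> \<epsilon> * real (card A)" "\<forall>a\<in>A - S'. \<forall>b\<in>(W - T) - A. \<not> E a b"
      using cut[of "W - T"] by auto
    have finA: "finite A" using A(1) fin finite_subset by blast
    have cTA: "card (T \<union> A) = card T + card A"
      using A(1) finA finT by (intro card_Un_disjoint) auto
    have "P (T \<union> A) (S \<union> S')" unfolding P_def
    proof (intro conjI)
      have "card (S \<union> S') \<le> card S + card S'" by (rule card_Un_le)
      then show "real (card (S \<union> S')) \<le> \<epsilon> * real (card (T \<union> A))"
        using S A(5) cTA by (simp add: P_def algebra_simps)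
      \<comment> \<open>|T| < |W| / 3 and |A| \<le> (|W| - |T|) / 2 give |T| + |A| \<le> (|W| + |T|)
        / 2 < 2 |W| / 3.\<close>
      show "3 * card (T \<union> A) \<le> 2 * card W" using A(3) cTA cWT small by linarith
      show "\<forall>a\<in>T \<union> A - (S \<union> S'). \<forall>b\<in>W - (T \<union> A). \<not> E a b"
        using S A(6) by (auto simp: P_def)
    qed (use TW ST A in auto)
    then have "card (T \<union> A) \<le> card T" using max by blast
    then show False using cTA A(2) finA by (simp add: card_eq_0_iff)
  qed
  have "balanced_sep E W S"
  proof (rule balanced_sepI[of S W "T - S" "W - T"])
    have "card (T - S) \<le> card T" using finT by (simp add: card_mono)
    then show "3 * card (T - S) \<le> 2 * card W" using S by (simp add: P_def)
    show "3 * card (W - T) \<le> 2 * card W" using large cWT by linarith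
    show "\<not> E a b" if "a \<in> T - S" "b \<in> W - T" for a b using S that by (simp add: P_def)
  qed (use TW ST in auto)
  moreover have "real (card S) \<le> \<epsilon> * real (card W)"
  proof -
    have "\<epsilon> * real (card T) \<le> \<epsilon> * real (card W)" using cTW \<open>\<epsilon> \<ge> 0\<close> by (simp add: mult_left_mono)
    then show ?thesis using S by (simp add: P_def)
  qed
  ultimately show ?thesis by blast
qed

section \<open>Weighted centroids of forests\<close>

text \<open>For finite \<open>X\<close> and symmetric irreflexive \<open>E\<close> these are exactly
  the forests, in a form made for stripping leaves.\<close>

definition one_degenerate :: "('a \<Rightarrow> 'a \<Rightarrow> bool) \<Rightarrow> 'a set \<Rightarrow> bool" where
  "one_degenerate E X \<longleftrightarrow> (\<forall>Y\<subseteq>X. Y \<noteq> {} \<longrightarrow> (\<exists>u\<in>Y. card {w\<in>Y. E u w} \<le> 1))"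

text \<open>Weights allow a stripped leaf to hand its weight to its neighbour.\<close>

definition centroid :: "('a \<Rightarrow> 'a \<Rightarrow> bool) \<Rightarrow> ('a \<Rightarrow> nat) \<Rightarrow> 'a set \<Rightarrow> 'a \<Rightarrow> bool" where
  "centroid E w X v \<longleftrightarrow> v \<in> X \<and>
     (\<exists>A B. A \<union> B = X - {v} \<and> A \<inter> B = {} \<and> 3 * sum w A \<le> 2 * sum w X \<and>
        3 * sum w B \<le> 2 * sum w X \<and> (\<forall>a\<in>A. \<forall>b\<in>B. \<not> E a b))"

lemma centroidI:
  assumes "v \<in> X" "A \<union> B = X - {v}" "A \<inter> B = {}" "3 * sum w A \<le> 2 * sum w X"
    "3 * sum w B \<le> 2 * sum w X" "\<forall>a\<in>A. \<forall>b\<in>B. \<not> E a b"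
  shows "centroid E w X v"
  unfolding centroid_def
  by (rule conjI, rule assms(1), rule exI[of _ A], rule exI[of _ B]) (use assms(2-) in simp)

text \<open>Two of the three parts can always share a side: if every pair weighed more than two
  thirds of \<open>X\<close>, adding the three pairs would give a total above the weight of
  \<open>X\<close>.\<close>

lemma centroid_merge:
  fixes w :: "'a \<Rightarrow> nat"
  assumes fin: "finite X" and cov: "A \<union> B \<union> C = X - {v}" and v: "v \<in> X"
    and disj: "A \<inter> B = {}" "A \<inter> C = {}" "B \<inter> C = {}"
    and wt: "3 * sum w A \<le> 2 * sum w X" "3 * sum w B \<le> 2 * sum w X" "3 * sum w C \<le> 2 * sum w X"
    and no: "\<forall>a\<in>A. \<forall>b\<in>B. \<not> E a b" "\<forall>a\<in>A. \<forall>b\<in>C. \<not> E a b" "\<forall>a\<in>B. \<forall>b\<in>C. \<not> E a b"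
    and sym: "\<And>a b. E a b \<Longrightarrow> E b a"
  shows "centroid E w X v"
proof -
  have fins: "finite A" "finite B" "finite C"
    using finite_subset[of _ "X - {v}"] fin cov by auto
  have sums: "sum w (A \<union> B) = sum w A + sum w B" "sum w (A \<union> C) = sum w A + sum w C"
    "sum w (B \<union> C) = sum w B + sum w C"
    using fins disj by (auto intro: sum.union_disjoint)
  have "sum w A + sum w B + sum w C = sum w (A \<union> B \<union> C)"
    using fins disj sums(1) by (subst sum.union_disjoint) auto
  also have "\<dots> \<le> sum w X" using cov fin by (intro sum_mono2) auto
  finally have total: "sum w A + sum w B + sum w C \<le> sum w X" .
  have "3 * sum w (A \<union> B) \<le> 2 * sum w X \<or> 3 * sum w (A \<union> C) \<le> 2 * sum w X \<or>
    3 * sum w (B \<union> C) \<le> 2 * sum w X"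
  proof (rule ccontr)
    assume "\<not> ?thesis"
    then have "2 * sum w X < 3 * sum w (A \<union> B)" "2 * sum w X < 3 * sum w (A \<union> C)"
      "2 * sum w X < 3 * sum w (B \<union> C)" by (simp_all add: not_le)
    then show False using total unfolding sums by (simp add: algebra_simps)
  qed
  then show ?thesis
  proof (elim disjE)
    assume "3 * sum w (A \<union> B) \<le> 2 * sum w X"
    then show ?thesis using cov disj wt v no by (intro centroidI[of v X "A \<union> B" C]) auto
  next
    assume "3 * sum w (A \<union> C) \<le> 2 * sum w X"
    moreover have "\<forall>a\<in>C. \<forall>b\<in>B. \<not> E a b" using no(3) sym by blast
    ultimately show ?thesis using cov disj wt v no by (intro centroidI[of v X "A \<union> C" B]) auto
  next
    assume "3 * sum w (B \<union> C) \<le> 2 * sum w X"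
    then show ?thesis using cov disj wt v no by (intro centroidI[of v X A "B \<union> C"]) auto
  qed
qed

text \<open>Induction on the number of vertices: strip a vertex \<open>u\<close> of degree at most
  one, move its weight to its neighbour, take a centroid of the rest and put \<open>u\<close> back
  on the side of its neighbour.\<close>

lemma forest_centroid:
  fixes w :: "'a \<Rightarrow> nat"
  assumes "finite X" "X \<noteq> {}" "one_degenerate E X"
    and sym: "\<And>a b. E a b \<Longrightarrow> E b a" and irr: "\<And>a. \<not> E a a"
  shows "\<exists>v. centroid E w X v"
  using assms(1-3)
proof (induction "card X" arbitrary: X w)
  case 0
  then show ?case by simp
next
  case (Suc n)
  obtain u where u: "u \<in> X" "card {z\<in>X. E u z} \<le> 1"
    using Suc.prems unfolding one_degenerate_def by blast
  let ?X = "X - {u}"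
  show ?case
  proof (cases "?X = {}")
    case True
    then have X: "X = {u}" using u(1) by blast
    have "centroid E w X u" by (rule centroidI[of _ _ "{}" "{}"]) (simp_all add: X)
    then show ?thesis ..
  next
    case False
    have od: "one_degenerate E ?X" using Suc.prems(3) unfolding one_degenerate_def by blast
    have finX: "finite ?X" using Suc.prems(1) by simp
    have cX: "n = card ?X" using Suc.hyps(2) Suc.prems(1) u(1) by simp
    have sumX: "sum w X = w u + sum w ?X" using Suc.prems(1) u(1) by (simp add: sum.remove)
    consider (heavy) "3 * w u > 2 * sum w X" | (iso) "3 * w u \<le> 2 * sum w X" "{z\<in>X. E u z} = {}"
      | (leaf) z where "3 * w u \<le> 2 * sum w X" "{z\<in>X. E u z} = {z}"
    proof (cases "3 * w u > 2 * sum w X")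
      case False
      consider "card {z\<in>X. E u z} = 0" | "card {z\<in>X. E u z} = 1" using u(2) by linarith
      then show thesis
      proof cases
        case 1
        then show thesis using that(2) False Suc.prems(1) by simp
      next
        case 2
        then show thesis using that(3) False by (metis card_1_singletonE not_less)
      qed
    qed
    then show ?thesis
    proof cases
      \<comment> \<open>A vertex with more than two thirds of the weight is itself a centroid. In
        the other cases \<open>{u}\<close> is light enough to serve as a third part.\<close>
      case heavy
      then have "3 * sum w ?X \<le> 2 * sum w X" using sumX by linarith
      then have "centroid E w X u" using u(1) by (intro centroidI[of u X ?X "{}"]) auto
      then show ?thesis ..
    next
      case iso
      obtain v A B where v: "v \<in> ?X" "A \<union> B = ?X - {v}" "A \<inter> B = {}" "3 * sum w A \<le> 2 * sum w ?X"
        "3 * sum w B \<le> 2 * sum w ?X" "\<forall>a\<in>A. \<forall>b\<in>B. \<not> E a b"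
        using Suc.hyps(1)[OF cX finX False od, of w] unfolding centroid_def by blast
      have "centroid E w X v"
      proof (rule centroid_merge[where A = A and B = B and C = "{u}"])
        show "\<forall>a\<in>A. \<forall>b\<in>{u}. \<not> E a b" "\<forall>a\<in>B. \<forall>b\<in>{u}. \<not> E a b"
          using iso(2) v(2) sym by blast+
        show "A \<union> B \<union> {u} = X - {v}" using v(1,2) u(1) by auto
      qed (use v u iso sumX Suc.prems(1) sym in auto)
      then show ?thesis ..
    next
      case leaf
      have zX: "z \<in> ?X" and Euz: "E u z" and only: "\<And>y. y \<in> X \<Longrightarrow> E u y \<Longrightarrow> y = z"
        using leaf(2) irr by blast+
      \<comment> \<open>With the weight of \<open>u\<close> moved to \<open>z\<close>, the total
        over \<open>?X\<close> equals that of \<open>w\<close> over \<open>X\<close>, so the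
        thresholds are unchanged.\<close>
      define w' where "w' = w(z := w z + w u)"
      have w': "sum w' Y = sum w Y + (if z \<in> Y then w u else 0)" if "Y \<subseteq> ?X" for Y
      proof -
        have "finite Y" using that finX finite_subset by blast
        then show ?thesis
          by (cases "z \<in> Y") (auto simp: w'_def sum.remove[of Y z] intro!: sum.cong)
      qed
      have w'X: "sum w' ?X = sum w X" using w'[of ?X] zX sumX by simp
      obtain v A B where v: "v \<in> ?X" "A \<union> B = ?X - {v}" "A \<inter> B = {}" "3 * sum w' A \<le> 2 * sum w X"
        "3 * sum w' B \<le> 2 * sum w X" "\<forall>a\<in>A. \<forall>b\<in>B. \<not> E a b"
        using Suc.hyps(1)[OF cX finX False od, of w'] unfolding w'X centroid_def by blast
      have AX: "A \<subseteq> ?X" "B \<subseteq> ?X" using v(2) by auto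
      have finAB: "finite A" "finite B" using AX finX finite_subset by blast+
      have uAB: "u \<notin> A" "u \<notin> B" using AX by auto
      consider "z = v" | "z \<in> A" | "z \<in> B" using zX v(2) by blast
      then have "centroid E w X v"
      proof cases
        \<comment> \<open>The neighbour is the centroid, so \<open>u\<close> is cut off from both
          sides and forms a part of its own.\<close>
        case 1
        have zAB: "z \<notin> A" "z \<notin> B" using 1 v(2) by auto
        show ?thesis
        proof (rule centroid_merge[where A = A and B = B and C = "{u}"])
          show "\<forall>a\<in>A. \<forall>b\<in>{u}. \<not> E a b" "\<forall>a\<in>B. \<forall>b\<in>{u}. \<not> E a b"
            using only AX zAB sym by blast+
          show "A \<union> B \<union> {u} = X - {v}" using v(1,2) u(1) by auto
          show "3 * sum w A \<le> 2 * sum w X" "3 * sum w B \<le> 2 * sum w X"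
            using v(4,5) w'[OF AX(1)] w'[OF AX(2)] zAB by auto
        qed (use v u leaf(1) uAB Suc.prems(1) sym in auto)
      next
        case 2
        then have "z \<notin> B" using v(3) by blast
        then have no: "\<forall>b\<in>B. \<not> E u b" using only AX by blast
        have "3 * sum w (insert u A) \<le> 2 * sum w X" "3 * sum w B \<le> 2 * sum w X"
          using v(4,5) w'[OF AX(1)] w'[OF AX(2)] 2 finAB uAB by auto
        then show ?thesis using v u(1) no uAB
          by (intro centroidI[of v X "insert u A" B]) auto
      next
        case 3
        then have "z \<notin> A" using v(3) by blast
        then have no: "\<forall>b\<in>A. \<not> E b u" using only AX sym by blast
        have "3 * sum w (insert u B) \<le> 2 * sum w X" "3 * sum w A \<le> 2 * sum w X"
          using v(4,5) w'[OF AX(1)] w'[OF AX(2)] 3 finAB uAB by auto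
        then show ?thesis using v u(1) no uAB
          by (intro centroidI[of v X A "insert u B"]) auto
      qed
      then show ?thesis ..
    qed
  qed
qed

section \<open>Separators of graphs of high girth\<close>

primrec nball :: "('a \<Rightarrow> 'a \<Rightarrow> bool) \<Rightarrow> 'a set \<Rightarrow> 'a \<Rightarrow> nat \<Rightarrow> 'a set" where
  "nball E U v 0 = {v}"
| "nball E U v (Suc r) = nball E U v r \<union> {u \<in> U. \<exists>w\<in>nball E U v r. E w u}"

text \<open>A cycle is the list of its distinct vertices, closed by an edge from the last to the
  first; the minimum of three vertices keeps a single edge from counting as a cycle.\<close>

definition no_short_cycle :: "('a \<Rightarrow> 'a \<Rightarrow> bool) \<Rightarrow> 'a set \<Rightarrow> nat \<Rightarrow> bool" where
  "no_short_cycle E U g \<longleftrightarrow> (\<forall>xs. set xs \<subseteq> U \<longrightarrow> distinct xs \<longrightarrow> successively E xs \<longrightarrow>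
     3 \<le> length xs \<longrightarrow> length xs \<le> g \<longrightarrow> \<not> E (last xs) (hd xs))"

lemma nball_mono: "r \<le> s \<Longrightarrow> nball E U v r \<subseteq> nball E U v s"
  by (induction s) (auto simp: le_Suc_eq)

lemma nball_subset: "v \<in> U \<Longrightarrow> nball E U v r \<subseteq> U"
  by (induction r) auto

text \<open>For \<open>x\<close> in no ball around \<open>v\<close> the \<open>LEAST\<close> has no
  meaning, so the facts below assume that \<open>x\<close> lies in some ball.\<close>

definition dist_from :: "('a \<Rightarrow> 'a \<Rightarrow> bool) \<Rightarrow> 'a set \<Rightarrow> 'a \<Rightarrow> 'a \<Rightarrow> nat" where
  "dist_from E U v x = (LEAST s. x \<in> nball E U v s)"

lemma dist_from_le: "x \<in> nball E U v r \<Longrightarrow> dist_from E U v x \<le> r"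
  unfolding dist_from_def by (rule Least_le)

lemma in_nball_dist_from: "x \<in> nball E U v r \<Longrightarrow> x \<in> nball E U v (dist_from E U v x)"
  unfolding dist_from_def by (rule LeastI)

text \<open>\<open>y\<close> is a parent of \<open>x\<close> in breadth-first search: a neighbour in
  the ball of radius \<open>s\<close>, which cannot be closer to \<open>v\<close>, since
  \<open>x\<close> would then be closer too.\<close>

lemma dist_from_Suc:
  assumes "x \<in> nball E U v r" "dist_from E U v x = Suc s"
  obtains y where "y \<in> nball E U v r" "dist_from E U v y = s" "E y x"
proof -
  have "x \<in> nball E U v (Suc s)" using in_nball_dist_from[OF assms(1)] assms(2) by simp
  moreover have "x \<notin> nball E U v s" using dist_from_le[of x E U v s] assms(2) by auto
  ultimately obtain y where y: "x \<in> U" "y \<in> nball E U v s" "E y x" by auto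
  have "s \<le> dist_from E U v y"
  proof (rule ccontr)
    assume "\<not> s \<le> dist_from E U v y"
    moreover have "x \<in> nball E U v (Suc (dist_from E U v y))"
      using in_nball_dist_from[OF y(2)] y(1,3) by auto
    ultimately show False using nball_mono[of "Suc (dist_from E U v y)" s E U v] \<open>x \<notin> nball E U v s\<close> by auto
  qed
  then have "dist_from E U v y = s" using dist_from_le[OF y(2)] by simp
  moreover have "s \<le> r" using dist_from_le[OF assms(1)] assms(2) by simp
  ultimately show thesis using that y nball_mono[of s r E U v] by blast
qed

text \<open>Colours alternate along shortest paths. Consequently no edge joins two vertices of the
  same level.\<close>

lemma dist_from_colour:
  assumes col: "\<And>a b. E a b \<Longrightarrow> c a \<noteq> (c b :: bool)" and "x \<in> nball E U v r"
  shows "c x = (c v \<longleftrightarrow> even (dist_from E U v x))"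
  using assms(2)
proof (induction "dist_from E U v x" arbitrary: x)
  case 0
  then have "x = v" using in_nball_dist_from[OF "0.prems"] by (simp flip: "0.hyps")
  with "0.hyps" have "dist_from E U v v = 0" by simp
  then show ?case using \<open>x = v\<close> by simp
next
  case (Suc s)
  obtain y where y: "y \<in> nball E U v r" "dist_from E U v y = s" "E y x"
    using dist_from_Suc[OF Suc.prems] Suc.hyps(2) by metis
  then show ?case using Suc.hyps(1)[of y] Suc.hyps(2) col[OF y(3)] by (auto simp flip: Suc.hyps(2))
qed

text \<open>Climb from \<open>a\<close> and \<open>b\<close> through parents until the two ancestors
  coincide. Each level adds one vertex at either end, outside the smaller ball that holds the path
  so far, so the path stays simple.\<close>

lemma path_through_ancestor:
  assumes sym: "\<And>a b. E a b \<Longrightarrow> E b a"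
    and "a \<in> nball E U v r" "b \<in> nball E U v r" "a \<noteq> b"
    and "dist_from E U v a = s" "dist_from E U v b = s"
  shows "\<exists>zs. zs \<noteq> [] \<and> hd zs = a \<and> last zs = b \<and> distinct zs \<and> successively E zs \<and>
    set zs \<subseteq> nball E U v s \<and> 3 \<le> length zs \<and> length zs \<le> 2 * s + 1"
  using assms(2-)
proof (induction s arbitrary: a b)
  case 0
  then have "a \<in> nball E U v 0" "b \<in> nball E U v 0"
    using in_nball_dist_from[of a E U v r] in_nball_dist_from[of b E U v r] by simp_all
  then show ?case using \<open>a \<noteq> b\<close> by simp
next
  case (Suc s)
  obtain a' where a': "a' \<in> nball E U v r" "dist_from E U v a' = s" "E a' a"
    using dist_from_Suc[OF Suc.prems(1,4)] by metis
  obtain b' where b': "b' \<in> nball E U v r" "dist_from E U v b' = s" "E b' b"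
    using dist_from_Suc[OF Suc.prems(2,5)] by metis
  have new: "a \<notin> nball E U v s" "b \<notin> nball E U v s"
    using dist_from_le[of _ E U v s] Suc.prems(4,5) by fastforce+
  have ab: "a \<in> nball E U v (Suc s)" "b \<in> nball E U v (Suc s)"
    using in_nball_dist_from[of _ E U v r] Suc.prems by metis+
  have a's: "a' \<in> nball E U v s" using in_nball_dist_from[OF a'(1)] a'(2) by simp
  have mono: "nball E U v s \<subseteq> nball E U v (Suc s)" by auto
  show ?case
  proof (cases "a' = b'")
    case True
    show ?thesis
      using True a' b' a's new ab sym Suc.prems(3) mono by (intro exI[of _ "[a, a', b]"]) auto
  next
    case False
    from Suc.IH[OF a'(1) b'(1) False a'(2) b'(2)]
    obtain zs where zs: "zs \<noteq> []" "hd zs = a'" "last zs = b'" "distinct zs" "successively E zs"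
      "set zs \<subseteq> nball E U v s" "3 \<le> length zs" "length zs \<le> 2 * s + 1" by blast
    have "successively E (a # zs @ [b])"
      using zs a' b' sym by (auto simp: successively_Cons successively_append_iff)
    moreover have "distinct (a # zs @ [b])" using zs new Suc.prems(3) by auto
    moreover have "set (a # zs @ [b]) \<subseteq> nball E U v (Suc s)" using zs(6) mono ab by auto
    ultimately show ?thesis using zs by (intro exI[of _ "a # zs @ [b]"]) auto
  qed
qed

text \<open>In any \<open>Y\<close> take the vertex \<open>u\<close> farthest from \<open>v\<close>.
  Its neighbours in \<open>Y\<close> all lie one level lower, and two of them would close a short
  cycle through a common ancestor.\<close>

lemma one_degenerate_nball:
  assumes sym: "\<And>a b. E a b \<Longrightarrow> E b a" and col: "\<And>a b. E a b \<Longrightarrow> c a \<noteq> (c b :: bool)"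
    and fin: "finite U" and v: "v \<in> U" and girth: "no_short_cycle E U (2 * r)"
  shows "one_degenerate E (nball E U v r)"
  unfolding one_degenerate_def
proof (intro allI impI)
  fix Y assume Y: "Y \<subseteq> nball E U v r" "Y \<noteq> {}"
  let ?d = "dist_from E U v"
  have YU: "Y \<subseteq> U" using Y(1) nball_subset[OF v, of E r] by blast
  then have finY: "finite Y" using fin finite_subset by blast
  obtain y where "y \<in> Y" using Y(2) by blast
  moreover have "\<forall>x. x \<in> Y \<longrightarrow> ?d x < Suc r"
    using Y(1) dist_from_le[of _ E U v r] by (auto simp: less_Suc_eq_le)
  ultimately have "\<exists>x. x \<in> Y \<and> (\<forall>y. y \<in> Y \<longrightarrow> ?d y \<le> ?d x)"
    by (rule ex_has_greatest_nat[of "\<lambda>x. x \<in> Y"])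
  then obtain u where u: "u \<in> Y" "\<And>y. y \<in> Y \<Longrightarrow> ?d y \<le> ?d u" by blast
  \<comment> \<open>Equal levels are excluded by the colouring, higher ones by the choice of
    \<open>u\<close>, and levels differ by at most one along an edge.\<close>
  have below: "?d u = Suc (?d a)" if a: "a \<in> Y" "E u a" for a
  proof -
    have "a \<in> nball E U v r" "u \<in> nball E U v r" using a(1) u(1) Y(1) by auto
    then have "?d a \<noteq> ?d u"
      using dist_from_colour[where E = E and c = c, OF col, of a U v r]
        dist_from_colour[where E = E and c = c, OF col, of u U v r]
        col[OF a(2)] by auto
    moreover have "u \<in> nball E U v (Suc (?d a))"
      using in_nball_dist_from[OF \<open>a \<in> nball E U v r\<close>] sym[OF a(2)] u(1) YU by auto
    ultimately show ?thesis using u(2)[OF a(1)] dist_from_le[of u E U v "Suc (?d a)"] by simp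
  qed
  have "a = b" if ab: "a \<in> Y" "E u a" "b \<in> Y" "E u b" for a b
  proof (rule ccontr)
    assume "a \<noteq> b"
    have eq: "?d b = ?d a" using below[OF ab(1,2)] below[OF ab(3,4)] by simp
    have "a \<in> nball E U v r" "b \<in> nball E U v r" using ab Y(1) by auto
    from path_through_ancestor[where E = E, OF sym this \<open>a \<noteq> b\<close> refl eq]
    obtain zs where zs: "zs \<noteq> []" "hd zs = a" "last zs = b" "distinct zs" "successively E zs"
      "set zs \<subseteq> nball E U v (?d a)" "3 \<le> length zs" "length zs \<le> 2 * ?d a + 1" by blast
    have "u \<notin> nball E U v (?d a)"
      using dist_from_le[of u E U v "?d a"] below[OF ab(1,2)] by auto
    then have "distinct (u # zs)" using zs by auto
    moreover have "successively E (u # zs)" using zs ab(2) by (simp add: successively_Cons)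
    moreover have "set (u # zs) \<subseteq> U" using zs(6) nball_subset[OF v, of E "?d a"] u(1) YU by auto
    \<comment> \<open>The cycle has at most \<open>2 * ?d a + 2 = 2 * ?d u\<close> vertices.\<close>
    moreover have "length (u # zs) \<le> 2 * r"
      using zs(8) below[OF ab(1,2)] dist_from_le[of u E U v r] u(1) Y(1) by auto
    ultimately have "\<not> E (last (u # zs)) (hd (u # zs))"
      using girth zs(7) unfolding no_short_cycle_def by (metis le_SucI length_Cons)
    then show False using zs sym ab(4) by simp
  qed
  then have "card {w\<in>Y. E u w} \<le> Suc 0"
    using finY by (subst card_le_Suc0_iff_eq) auto
  then show "\<exists>u\<in>Y. card {w\<in>Y. E u w} \<le> 1" using u(1) by (intro bexI[of _ u]) simp_all
qed

section \<open>Region growing\<close>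

text \<open>Otherwise each of the first \<open>n\<^sup>2\<close> steps multiplies the ball by more
  than \<open>1 + 1 / n\<close>, and since \<open>(1 + 1 / n) ^ n \<ge> 2\<close> the ball outgrows
  \<open>2 ^ n\<close>.\<close>

lemma slow_growth_radius:
  assumes fin: "finite U" and v: "v \<in> U" and card: "card U \<le> 2 ^ n" and n: "n \<ge> 1"
  shows "\<exists>r<n\<^sup>2. n * card (nball E U v (Suc r) - nball E U v r) \<le> card (nball E U v r)"
proof (rule ccontr)
  let ?B = "nball E U v"
  assume "\<not> ?thesis"
  then have grow: "card (?B r) < n * card (?B (Suc r) - ?B r)" if "r < n\<^sup>2" for r
    using that by (meson not_le)
  have finB: "finite (?B r)" for r using nball_subset[OF v] fin finite_subset by metis
  have step: "(1 + 1 / real n) * real (card (?B r)) < real (card (?B (Suc r)))" if "r < n\<^sup>2" for r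
  proof -
    have "card (?B (Suc r)) = card (?B r) + card (?B (Suc r) - ?B r)"
      using card_Diff_subset[OF finB nball_mono, of r "Suc r"] card_mono[OF finB nball_mono, of r "Suc r"]
      by simp
    moreover have "real (card (?B r)) < real n * real (card (?B (Suc r) - ?B r))"
      using grow[OF that] by (metis of_nat_less_iff of_nat_mult)
    ultimately show ?thesis using n by (simp add: field_simps)
  qed
  have pow: "r \<le> n\<^sup>2 \<Longrightarrow> (1 + 1 / real n) ^ r \<le> real (card (?B r))" for r
  proof (induction r)
    case (Suc r)
    have "(1 + 1 / real n) ^ Suc r = (1 + 1 / real n) * (1 + 1 / real n) ^ r" by simp
    also have "\<dots> \<le> (1 + 1 / real n) * real (card (?B r))"
      using Suc by (intro mult_left_mono) auto
    also have "\<dots> \<le> real (card (?B (Suc r)))" using step[of r] Suc.prems by simp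
    finally show ?case .
  qed simp
  have "- 1 \<le> 1 / real n" by (rule order_trans[of _ 0]) auto
  then have "(2::real) \<le> (1 + 1 / real n) ^ n"
    using Bernoulli_inequality[of "1 / real n" n] n by simp
  then have "2 ^ n \<le> ((1 + 1 / real n) ^ n) ^ n" by (intro power_mono) auto
  \<comment> \<open>The last step is split off because its strict growth yields the strict
    inequality.\<close>
  also have "\<dots> = (1 + 1 / real n) ^ Suc (n\<^sup>2 - 1)" using n by (simp add: power2_eq_square power_mult)
  also have "\<dots> = (1 + 1 / real n) * (1 + 1 / real n) ^ (n\<^sup>2 - 1)" by simp
  also have "\<dots> \<le> (1 + 1 / real n) * real (card (?B (n\<^sup>2 - 1)))"
    using pow by (intro mult_left_mono) auto
  also have "\<dots> < real (card (?B (Suc (n\<^sup>2 - 1))))" using n by (intro step) simp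
  also have "\<dots> \<le> real (card U)" using nball_subset[OF v] fin by (intro of_nat_mono card_mono) auto
  finally show False using card by (simp add: not_less)
qed

lemma one_degenerate_Un:
  assumes "one_degenerate E X" "one_degenerate E Y" "\<And>a b. a \<in> X \<Longrightarrow> b \<in> Y \<Longrightarrow> \<not> E a b"
  shows "one_degenerate E (X \<union> Y)"
  unfolding one_degenerate_def
proof (intro allI impI)
  fix Z assume Z: "Z \<subseteq> X \<union> Y" "Z \<noteq> {}"
  show "\<exists>u\<in>Z. card {w \<in> Z. E u w} \<le> 1"
  proof (cases "Z \<inter> X = {}")
    case True
    then show ?thesis using Z assms(2) unfolding one_degenerate_def by blast
  next
    case False
    then obtain u where u: "u \<in> Z \<inter> X" "card {w \<in> Z \<inter> X. E u w} \<le> 1"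
      using assms(1) unfolding one_degenerate_def by blast
    have "{w \<in> Z. E u w} = {w \<in> Z \<inter> X. E u w}" using u(1) Z(1) assms(3) by blast
    then show ?thesis using u by (intro bexI[of _ u]) simp_all
  qed
qed

lemma no_short_cycle_subset:
  assumes "no_short_cycle E U g" "V \<subseteq> U" "h \<le> g"
  shows "no_short_cycle E V h"
  unfolding no_short_cycle_def
proof (intro allI impI)
  fix xs assume xs: "set xs \<subseteq> V" "distinct xs" "successively E xs" "3 \<le> length xs" "length xs \<le> h"
  then have "set xs \<subseteq> U" "length xs \<le> g" using assms(2,3) by auto
  then show "\<not> E (last xs) (hd xs)" using assms(1) xs unfolding no_short_cycle_def by blast
qed

text \<open>Take a slowly growing ball, delete its boundary layer, which costs at most the fraction
  \<open>1 / n\<close> of the ball, and recurse outside. The radius is below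
  \<open>n\<^sup>2\<close>, so by the girth assumption the ball is a forest.\<close>

lemma remove_to_forest:
  assumes sym: "\<And>a b. E a b \<Longrightarrow> E b a" and col: "\<And>a b. E a b \<Longrightarrow> c a \<noteq> (c b :: bool)"
    and n: "n \<ge> 1"
    and "finite U" "card U \<le> 2 ^ n" "no_short_cycle E U (2 * n\<^sup>2)"
  shows "\<exists>S\<subseteq>U. n * card S \<le> card U \<and> one_degenerate E (U - S)"
  using assms(4-)
proof (induction "card U" arbitrary: U rule: less_induct)
  case less
  show ?case
  proof (cases "U = {}")
    case True
    then show ?thesis by (auto simp: one_degenerate_def)
  next
    case False
    then obtain v where v: "v \<in> U" by blast
    let ?B = "nball E U v"
    obtain r where r: "r < n\<^sup>2" "n * card (?B (Suc r) - ?B r) \<le> card (?B r)"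
      using slow_growth_radius[OF less.prems(1) v less.prems(2) n, of E] by blast
    let ?U = "U - ?B (Suc r)"
    have BU: "?B (Suc r) \<subseteq> U" "?B r \<subseteq> ?B (Suc r)"
      using nball_subset[OF v] nball_mono[of r "Suc r"] by auto
    have vB: "v \<in> ?B (Suc r)" using nball_mono[of 0 "Suc r" E U v] by auto
    then have "card ?U < card U" using v less.prems(1) by (intro psubset_card_mono) auto
    moreover have "card ?U \<le> 2 ^ n" using calculation less.prems(2) by linarith
    ultimately obtain S where S: "S \<subseteq> ?U" "n * card S \<le> card ?U" "one_degenerate E (?U - S)"
      using less.hyps[of ?U] less.prems(1) no_short_cycle_subset[OF less.prems(3)] by auto
    let ?S = "(?B (Suc r) - ?B r) \<union> S"
    have "card ?S \<le> card (?B (Suc r) - ?B r) + card S" by (rule card_Un_le)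
    then have "n * card ?S \<le> n * card (?B (Suc r) - ?B r) + n * card S"
      by (metis distrib_left mult_le_mono2)
    also have "\<dots> \<le> card (?B r) + card ?U" using r(2) S(2) by linarith
    also have "\<dots> = card (?B r \<union> ?U)"
      using BU less.prems(1) finite_subset by (intro card_Un_disjoint[symmetric]) auto
    also have "\<dots> \<le> card U" using BU less.prems(1) by (intro card_mono) auto
    finally have 1: "n * card ?S \<le> card U" .
    have "one_degenerate E (?B r \<union> (?U - S))"
    proof (rule one_degenerate_Un)
      show "one_degenerate E (?B r)"
        using r(1) by (intro one_degenerate_nball[OF sym col less.prems(1) v]
            no_short_cycle_subset[OF less.prems(3)]) auto
    qed (use S(3) in auto)
    moreover have "U - ?S = ?B r \<union> (?U - S)" using BU S(1) by blast
    ultimately show ?thesis using 1 BU S(1) by (intro exI[of _ ?S]) auto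
  qed
qed

text \<open>The deleted layers together with a centroid of the remaining forest form the separator;
  the centroid accounts for the extra \<open>1\<close>.\<close>

lemma high_girth_separator:
  assumes sym: "\<And>a b. E a b \<Longrightarrow> E b a" and col: "\<And>a b. E a b \<Longrightarrow> c a \<noteq> (c b :: bool)"
    and "n \<ge> 1" and fin: "finite W" and "card W \<le> 2 ^ n" "no_short_cycle E W (2 * n\<^sup>2)"
  shows "\<exists>S. balanced_sep E W S \<and> real (card S) \<le> real (card W) / real n + 1"
proof -
  obtain S where S: "S \<subseteq> W" "n * card S \<le> card W" "one_degenerate E (W - S)"
    using remove_to_forest[where E = E and c = c, OF assms] by blast
  have "real n * real (card S) \<le> real (card W)" using S(2) by (metis of_nat_le_iff of_nat_mult)
  then have cS: "real (card S) \<le> real (card W) / real n" using \<open>n \<ge> 1\<close> by (simp add: field_simps)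
  have irr: "\<not> E a a" for a using col[of a a] by blast
  show ?thesis
  proof (cases "W = S")
    case True
    have "balanced_sep E W S" using True by (intro balanced_sepI[of S W "{}" "{}"]) auto
    then show ?thesis using cS by (intro exI[of _ S]) simp
  next
    case False
    then have "W - S \<noteq> {}" using S(1) by blast
    then obtain v where "centroid E (\<lambda>_. 1) (W - S) v"
      using forest_centroid[where E = E, OF _ _ S(3) sym irr, of "\<lambda>_. 1"] fin by auto
    then obtain A B where v: "v \<in> W - S" "A \<union> B = W - S - {v}" "A \<inter> B = {}"
      "3 * card A \<le> 2 * card (W - S)" "3 * card B \<le> 2 * card (W - S)" "\<forall>a\<in>A. \<forall>b\<in>B. \<not> E a b"
      unfolding centroid_def by auto
    have "card (W - S) \<le> card W" using fin by (simp add: card_mono)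
    then have "balanced_sep E W (insert v S)"
      using v S(1) by (intro balanced_sepI[of _ W A B]) auto
    moreover have "card (insert v S) \<le> card S + 1" by (simp add: card_insert_le_m1 card_insert_if fin finite_subset[OF S(1)])
    ultimately show ?thesis using cS by (intro exI[of _ "insert v S"]) auto
  qed
qed

section \<open>Coordinate cuts of the hypercube\<close>

text \<open>Points of the cube are represented by the set of their coordinates equal to one.\<close>

definition flip :: "'a \<Rightarrow> 'a set \<Rightarrow> 'a set" where
  "flip i u = (if i \<in> u then u - {i} else insert i u)"

text \<open>\<open>finite u\<close> makes the parity of \<open>card\<close> a proper 2-colouring,
  since infinite sets all have \<open>card\<close> 0. The dimension enters only through the vertex
  sets.\<close>

definition cube_adj :: "'a set \<Rightarrow> 'a set \<Rightarrow> bool" where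
  "cube_adj u v \<longleftrightarrow> finite u \<and> (\<exists>i. v = flip i u)"

lemma in_flip: "j \<in> flip i u \<longleftrightarrow> (if j = i then i \<notin> u else j \<in> u)"
  by (auto simp: flip_def)

lemma flip_flip [simp]: "flip i (flip i u) = u"
  by (auto simp: flip_def)

lemma flip_eq_iff: "flip i u = flip j u \<longleftrightarrow> i = j"
  by (metis in_flip)

lemma finite_flip [simp]: "finite (flip i u) \<longleftrightarrow> finite u"
  by (simp add: flip_def)

lemma cube_adj_sym: "cube_adj u v \<Longrightarrow> cube_adj v u"
  unfolding cube_adj_def by (metis finite_flip flip_flip)

lemma cube_adj_parity:
  assumes "cube_adj u v"
  shows "even (card u) \<noteq> even (card v)"
proof -
  obtain i where i: "finite u" "v = flip i u" using assms by (auto simp: cube_adj_def)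
  show ?thesis
  proof (cases "i \<in> u")
    case True
    then have "card u = Suc (card v)" using i card_Suc_Diff1[of u i] by (simp add: flip_def)
    then show ?thesis by simp
  next
    case False
    then have "card v = Suc (card u)" using i by (simp add: flip_def)
    then show ?thesis by simp
  qed
qed

text \<open>A set of at most \<open>D\<close> elements is listed as a word of length
  \<open>D\<close> over \<open>d + 1\<close> letters, the letter \<open>d\<close> serving as
  padding.\<close>

lemma card_sets_le:
  "card {x. x \<subseteq> {..<d::nat} \<and> card x \<le> D} \<le> (d + 1) ^ D"
proof -
  let ?L = "{l. set l \<subseteq> {..d} \<and> length l = D}"
  have "{x. x \<subseteq> {..<d} \<and> card x \<le> D} \<subseteq> (\<lambda>l. set l \<inter> {..<d}) ` ?L"
  proof
    fix x assume "x \<in> {x. x \<subseteq> {..<d} \<and> card x \<le> D}"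
    then have x: "x \<subseteq> {..<d}" "card x \<le> D" "finite x" using finite_subset by auto
    let ?l = "sorted_list_of_set x @ replicate (D - card x) d"
    have "?l \<in> ?L" using x by (auto simp: set_replicate_conv_if)
    moreover have "x = set ?l \<inter> {..<d}" using x by (auto simp: set_replicate_conv_if)
    ultimately show "x \<in> (\<lambda>l. set l \<inter> {..<d}) ` ?L" by blast
  qed
  moreover have "finite ?L" by (simp add: finite_lists_length_eq)
  ultimately have "card {x. x \<subseteq> {..<d} \<and> card x \<le> D} \<le> card ?L" by (meson surj_card_le)
  then show ?thesis by (simp add: card_lists_length_eq)
qed

lemma card_filter_sum: "finite A \<Longrightarrow> card {x \<in> A. P x} = (\<Sum>x\<in>A. if P x then 1 else 0)"
  by (simp add: sum.If_cases Int_def)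

lemma sum_card_filter_swap:
  assumes "finite A" "finite B"
  shows "(\<Sum>a\<in>A. card {b \<in> B. P a b}) = (\<Sum>b\<in>B. card {a \<in> A. P a b})"
  unfolding card_filter_sum[OF assms(1)] card_filter_sum[OF assms(2)] by (rule sum.swap)

text \<open>At most \<open>(d + 1) ^ D\<close> points, hence at most half of \<open>U\<close>, lie
  within Hamming distance \<open>D\<close> of a given point, so the distances from it sum to at
  least \<open>D * card U / 2\<close>. Over all ordered pairs and counted by coordinates, the
  distances sum to twice the sum of the products.\<close>

lemma pairwise_distance_sum:
  assumes U: "U \<subseteq> Pow {..<d::nat}" and card: "2 * (d + 1) ^ D \<le> card U"
  shows "D * card U * card U \<le> 4 * (\<Sum>i<d. card {u\<in>U. i \<in> u} * card {u\<in>U. i \<notin> u})"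
proof -
  have fin: "finite U" using U finite_subset by blast
  define dist where "dist u v = card {i \<in> {..<d}. (i \<in> u) \<noteq> (i \<in> v)}" for u v
  have far: "D * card U \<le> 2 * (\<Sum>v\<in>U. dist u v)" if u: "u \<in> U" for u
  proof -
    let ?N = "{v\<in>U. dist u v \<le> D}"
    let ?f = "\<lambda>v. {i \<in> {..<d}. (i \<in> u) \<noteq> (i \<in> v)}"
    have "inj_on ?f ?N"
    proof (rule inj_onI)
      fix v w assume vw: "v \<in> ?N" "w \<in> ?N" "?f v = ?f w"
      have "v \<subseteq> {..<d}" "w \<subseteq> {..<d}" using vw U by auto
      then show "v = w" using vw(3) by blast
    qed
    moreover have "?f ` ?N \<subseteq> {x. x \<subseteq> {..<d} \<and> card x \<le> D}" by (auto simp: dist_def)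
    ultimately have "card ?N \<le> card {x. x \<subseteq> {..<d} \<and> card x \<le> D}"
      by (rule card_inj_on_le) simp
    then have "2 * card ?N \<le> card U" using card_sets_le[of d D] card by linarith
    moreover have "card (U - ?N) = card U - card ?N" "card ?N \<le> card U"
      using fin by (auto intro: card_Diff_subset card_mono)
    ultimately have "card U \<le> 2 * card (U - ?N)" by linarith
    then have "D * card U \<le> 2 * (D * card (U - ?N))" by (metis mult.left_commute mult_le_mono2)
    also have "D * card (U - ?N) = (\<Sum>v\<in>U - ?N. D)" by simp
    also have "\<dots> \<le> (\<Sum>v\<in>U - ?N. dist u v)" by (intro sum_mono) auto
    also have "\<dots> \<le> (\<Sum>v\<in>U. dist u v)" using fin by (intro sum_mono2) auto
    finally show ?thesis by simp
  qed
  have pairs: "(\<Sum>u\<in>U. card {v\<in>U. (i \<in> u) \<noteq> (i \<in> v)}) = 2 * (card {u\<in>U. i \<in> u} * card {u\<in>U. i \<notin> u})" for i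
  proof -
    have "(\<Sum>u\<in>U. card {v\<in>U. (i \<in> u) \<noteq> (i \<in> v)}) =
        (\<Sum>u\<in>U. if i \<in> u then card {u\<in>U. i \<notin> u} else card {u\<in>U. i \<in> u})"
      by (intro sum.cong) (auto intro!: arg_cong[of _ _ card])
    also have "\<dots> = 2 * (card {u\<in>U. i \<in> u} * card {u\<in>U. i \<notin> u})"
      using fin by (simp add: sum.If_cases Int_def Collect_neg_eq[symmetric])
    finally show ?thesis .
  qed
  have "D * card U * card U = (\<Sum>u\<in>U. D * card U)" by simp
  also have "\<dots> \<le> (\<Sum>u\<in>U. 2 * (\<Sum>v\<in>U. dist u v))" using far by (intro sum_mono) auto
  also have "\<dots> = 2 * (\<Sum>u\<in>U. \<Sum>i<d. card {v\<in>U. (i \<in> u) \<noteq> (i \<in> v)})"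
    unfolding dist_def by (subst sum_card_filter_swap) (auto simp: fin sum_distrib_left)
  also have "(\<Sum>u\<in>U. \<Sum>i<d. card {v\<in>U. (i \<in> u) \<noteq> (i \<in> v)}) =
      (\<Sum>i<d. \<Sum>u\<in>U. card {v\<in>U. (i \<in> u) \<noteq> (i \<in> v)})" by (rule sum.swap)
  finally show ?thesis unfolding pairs by (simp flip: sum_distrib_left)
qed

text \<open>Averaging over coordinates: at most \<open>\<Delta> * card U\<close> edges face products
  of side sizes that sum to at least \<open>D * card U * card U / 4\<close>, so some coordinate has
  few edges relative to its product. The larger side has at most \<open>card U\<close> points, and
  cancelling it leaves a bound by the smaller side.\<close>

lemma sparse_coordinate_cut:
  assumes U: "U \<subseteq> Pow {..<d::nat}" and card: "2 * (d + 1) ^ D \<le> card U" and "D \<ge> 1"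
    and deg: "\<And>u. u \<in> U \<Longrightarrow> card {i \<in> {..<d}. flip i u \<in> U} \<le> \<Delta>"
  shows "\<exists>A S. A \<subseteq> U \<and> A \<noteq> {} \<and> 2 * card A \<le> card U \<and> S \<subseteq> A \<and> D * card S \<le> 4 * \<Delta> * card A \<and>
    (\<forall>a\<in>A - S. \<forall>b\<in>U - A. \<not> cube_adj a b)"
proof -
  have fin: "finite U" using U finite_subset by blast
  have posU: "card U > 0" using card by (metis (no_types) add_gr_0 less_le_trans mult_pos_pos pos2 zero_less_one zero_less_power)
  define A where "A i = {u\<in>U. i \<in> u}" for i
  define B where "B i = {u\<in>U. i \<notin> u}" for i
  define e where "e i = card {u\<in>U. i \<in> u \<and> flip i u \<in> U}" for i
  have sum_e: "(\<Sum>i<d. e i) \<le> \<Delta> * card U"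
  proof -
    have "(\<Sum>i<d. e i) = (\<Sum>u\<in>U. card {i \<in> {..<d}. i \<in> u \<and> flip i u \<in> U})"
      unfolding e_def using fin by (intro sum_card_filter_swap) auto
    also have "\<dots> \<le> (\<Sum>u\<in>U. \<Delta>)"
    proof (rule sum_mono)
      fix u assume "u \<in> U"
      have "card {i \<in> {..<d}. i \<in> u \<and> flip i u \<in> U} \<le> card {i \<in> {..<d}. flip i u \<in> U}"
        by (intro card_mono) auto
      with deg[OF \<open>u \<in> U\<close>] show "card {i \<in> {..<d}. i \<in> u \<and> flip i u \<in> U} \<le> \<Delta>" by simp
    qed
    finally show ?thesis by (simp add: mult.commute)
  qed
  have dist: "D * card U * card U \<le> 4 * (\<Sum>i<d. card (A i) * card (B i))"
    unfolding A_def B_def by (rule pairwise_distance_sum[OF U card])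
  \<comment> \<open>Positivity of the product makes both sides nonempty. Were the estimate to fail
    for all such \<open>i\<close>, summing over the coordinates would contradict
    \<open>sum_e\<close> and \<open>dist\<close>.\<close>
  have "\<exists>i<d. card (A i) * card (B i) > 0 \<and> D * card U * e i \<le> 4 * \<Delta> * (card (A i) * card (B i))"
  proof (rule ccontr)
    assume "\<not> ?thesis"
    then have bad: "4 * \<Delta> * (card (A i) * card (B i)) < D * card U * e i"
      if "i < d" "card (A i) * card (B i) > 0" for i using that by (meson not_le)
    have "0 < D * card U * card U" using posU \<open>D \<ge> 1\<close> by simp
    then have "0 < 4 * (\<Sum>i<d. card (A i) * card (B i))" using dist by (rule less_le_trans)
    then have "(\<Sum>i<d. card (A i) * card (B i)) \<noteq> 0" by linarith
    then obtain j where j: "j < d" "card (A j) * card (B j) > 0" by (auto simp: sum_eq_0_iff)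
    have "4 * \<Delta> * (\<Sum>i<d. card (A i) * card (B i)) < (\<Sum>i<d. D * card U * e i)"
      unfolding sum_distrib_left
    proof (rule sum_strict_mono_ex1)
      show "\<forall>i\<in>{..<d}. 4 * \<Delta> * (card (A i) * card (B i)) \<le> D * card U * e i"
        using bad by (metis lessThan_iff less_imp_le mult_0_right neq0_conv zero_le)
      show "\<exists>i\<in>{..<d}. 4 * \<Delta> * (card (A i) * card (B i)) < D * card U * e i"
        using bad[OF j] j(1) by blast
    qed simp
    also have "\<dots> = D * card U * (\<Sum>i<d. e i)" by (simp add: sum_distrib_left)
    also have "\<dots> \<le> D * card U * (\<Delta> * card U)" using sum_e by (rule mult_le_mono2)
    also have "\<dots> = \<Delta> * (D * card U * card U)" by simp
    also have "\<dots> \<le> \<Delta> * (4 * (\<Sum>i<d. card (A i) * card (B i)))" using dist by (rule mult_le_mono2)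
    finally show False by simp
  qed
  then obtain i where i: "i < d" "card (A i) * card (B i) > 0"
    "D * card U * e i \<le> 4 * \<Delta> * (card (A i) * card (B i))" by blast
  have fins: "finite (A i)" "finite (B i)" using fin by (auto simp: A_def B_def)
  have "U = A i \<union> B i" "A i \<inter> B i = {}" by (auto simp: A_def B_def)
  then have cU: "card U = card (A i) + card (B i)" using fins by (metis card_Un_disjoint)
  \<comment> \<open>\<open>X\<close> is the smaller side, whichever that is; the separator consists
    of its points whose \<open>i\<close>-neighbour is in \<open>U\<close>.\<close>
  have main: ?thesis
    if X: "X \<subseteq> U" "card X > 0" "2 * card X \<le> card U" "Y \<subseteq> U" "X = U - Y"
      and prod: "card (A i) * card (B i) = card X * card Y"
      and S: "card {u\<in>X. flip i u \<in> U} = e i"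
      and same: "\<And>a b. a \<in> X \<Longrightarrow> b \<in> Y \<Longrightarrow> (i \<in> a) \<noteq> (i \<in> b)" for X Y
  proof -
    have "D * e i * card U \<le> 4 * \<Delta> * (card X * card Y)" using i(3) prod by (simp add: ac_simps)
    also have "\<dots> \<le> 4 * \<Delta> * (card X * card U)" using X fin by (intro mult_le_mono2 card_mono) auto
    finally have "D * e i * card U \<le> 4 * \<Delta> * card X * card U" by (simp add: mult.assoc)
    then have "D * e i \<le> 4 * \<Delta> * card X" using posU by simp
    moreover have "\<not> cube_adj a b" if ab: "a \<in> X - {u\<in>X. flip i u \<in> U}" "b \<in> U - X" for a b
    proof
      assume "cube_adj a b"
      then obtain j where j: "b = flip j a" by (auto simp: cube_adj_def)
      have "b \<in> Y" using ab X by blast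
      then have "j = i" using same[of a b] ab j by (auto simp: in_flip split: if_splits)
      then show False using ab j by auto
    qed
    moreover have "X \<noteq> {}" using X(2) by auto
    ultimately show ?thesis using X(1,3) S by (intro exI[of _ X] exI[of _ "{u\<in>X. flip i u \<in> U}"]) auto
  qed
  show ?thesis
  proof (cases "card (A i) \<le> card (B i)")
    case True
    show ?thesis
    proof (rule main[of "A i" "B i"])
      show "card {u \<in> A i. flip i u \<in> U} = e i" unfolding A_def e_def by (simp add: conj_assoc)
      show "A i = U - B i" by (auto simp: A_def B_def)
    qed (use True i(2) cU in \<open>auto simp: A_def B_def\<close>)
  next
    case False
    show ?thesis
    proof (rule main[of "B i" "A i"])
      \<comment> \<open>\<open>flip i\<close> matches the two ends of the edges in direction
        \<open>i\<close>, so either side has \<open>e i\<close> of them.\<close>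
      have "bij_betw (flip i) {u\<in>U. i \<in> u \<and> flip i u \<in> U} {u \<in> B i. flip i u \<in> U}"
        by (rule bij_betw_byWitness[where f' = "flip i"]) (auto simp: B_def in_flip)
      then show "card {u \<in> B i. flip i u \<in> U} = e i"
        unfolding e_def by (simp add: bij_betw_same_card)
      show "B i = U - A i" by (auto simp: A_def B_def)
    qed (use False i(2) cU in \<open>auto simp: A_def B_def\<close>)
  qed
qed

text \<open>The iteration only meets sets \<open>U\<close> with more than two thirds of the points
  of \<open>W\<close>, so the factor 3 in the size assumption leaves the factor 2 that
  \<open>sparse_coordinate_cut\<close> asks of \<open>U\<close>.\<close>

lemma cube_separator:
  assumes W: "W \<subseteq> Pow {..<d::nat}" and card: "3 * (d + 1) ^ D \<le> card W" and D: "D \<ge> 1"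
    and deg: "\<And>u. u \<in> W \<Longrightarrow> card {i \<in> {..<d}. flip i u \<in> W} \<le> \<Delta>"
  shows "\<exists>S. balanced_sep cube_adj W S \<and> real (card S) \<le> 4 * real \<Delta> / real D * real (card W)"
proof (rule balanced_sep_iterate)
  show "finite W" using W finite_subset by blast
  show "\<exists>A S. A \<subseteq> U \<and> A \<noteq> {} \<and> 2 * card A \<le> card U \<and> S \<subseteq> A \<and>
      real (card S) \<le> 4 * real \<Delta> / real D * real (card A) \<and> (\<forall>a\<in>A - S. \<forall>b\<in>U - A. \<not> cube_adj a b)"
    if U: "U \<subseteq> W" "2 * card W < 3 * card U" for U
  proof -
    have "card {i \<in> {..<d}. flip i u \<in> U} \<le> \<Delta>" if "u \<in> U" for u
    proof -
      have "card {i \<in> {..<d}. flip i u \<in> U} \<le> card {i \<in> {..<d}. flip i u \<in> W}"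
        using U by (intro card_mono) auto
      with deg[of u] U that show ?thesis by force
    qed
    moreover have "2 * (d + 1) ^ D \<le> card U" using card U(2) by linarith
    moreover have "U \<subseteq> Pow {..<d}" using U W by blast
    ultimately obtain A S where AS: "A \<subseteq> U" "A \<noteq> {}" "2 * card A \<le> card U" "S \<subseteq> A"
      "D * card S \<le> 4 * \<Delta> * card A" "\<forall>a\<in>A - S. \<forall>b\<in>U - A. \<not> cube_adj a b"
      using sparse_coordinate_cut[of U d D \<Delta>] D by blast
    have "real D * real (card S) \<le> 4 * real \<Delta> * real (card A)"
      using AS(5) by (metis (mono_tags) of_nat_le_iff of_nat_mult of_nat_numeral)
    then have "real (card S) \<le> 4 * real \<Delta> / real D * real (card A)" using D by (simp add: field_simps)
    with AS show ?thesis by blast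
  qed
qed (auto intro: cube_adj_sym)

section \<open>Sparse subsets of the hypercube without short cycles\<close>

lemma sum_Pow_insert:
  assumes "finite V" "v \<notin> V"
  shows "(\<Sum>S\<in>Pow (insert v V). f S) = (\<Sum>S\<in>Pow V. f S + f (insert v S))"
proof -
  have "inj_on (insert v) (Pow V)" using assms(2) by (auto simp: inj_on_def insert_ident)
  moreover have "Pow V \<inter> insert v ` Pow V = {}" using assms(2) by auto
  ultimately show ?thesis
    using assms(1) by (simp add: Pow_insert sum.union_disjoint sum.reindex sum.distrib)
qed

text \<open>The weights are those of the random subset that contains each point independently with
  probability \<open>p\<close>.\<close>

lemma random_subset_weights:
  fixes p :: real
  assumes "finite V" "0 \<le> p" "p \<le> 1"
  shows "\<exists>q. (\<forall>S. 0 \<le> q S) \<and> (\<forall>A\<subseteq>V. (\<Sum>S\<in>Pow V. if A \<subseteq> S then q S else 0) = p ^ card A)"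
  using assms(1)
proof (induction V rule: finite_induct)
  case empty
  show ?case by (rule exI[of _ "\<lambda>_. 1"]) simp
next
  case (insert v V)
  obtain q where q: "\<And>S. 0 \<le> q S" "\<And>A. A \<subseteq> V \<Longrightarrow> (\<Sum>S\<in>Pow V. if A \<subseteq> S then q S else 0) = p ^ card A"
    using insert.IH by blast
  define q' where "q' S = (if v \<in> S then p else 1 - p) * q (S - {v})" for S
  have "(\<Sum>S\<in>Pow (insert v V). if A \<subseteq> S then q' S else 0) = p ^ card A" if A: "A \<subseteq> insert v V" for A
  proof -
    have v: "v \<notin> S" "S - {v} = S" "insert v S - {v} = S" if "S \<in> Pow V" for S
      using that insert.hyps by auto
    have "(\<Sum>S\<in>Pow (insert v V). if A \<subseteq> S then q' S else 0) =
        (\<Sum>S\<in>Pow V. (if A \<subseteq> S then (1 - p) * q S else 0) + (if A - {v} \<subseteq> S then p * q S else 0))"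
      unfolding sum_Pow_insert[OF insert.hyps]
      by (intro sum.cong refl arg_cong2[of _ _ _ _ "(+)"]) (auto simp: q'_def v subset_insert_iff)
    also have "\<dots> = (if v \<in> A then 0 else 1 - p) * (\<Sum>S\<in>Pow V. if A - {v} \<subseteq> S then q S else 0)
        + p * (\<Sum>S\<in>Pow V. if A - {v} \<subseteq> S then q S else 0)"
      unfolding sum.distrib sum_distrib_left
      using v(1) by (intro arg_cong2[of _ _ _ _ "(+)"] sum.cong) auto
    also have "(\<Sum>S\<in>Pow V. if A - {v} \<subseteq> S then q S else 0) = p ^ card (A - {v})"
      using A by (intro q(2)) auto
    also have "(if v \<in> A then 0 else 1 - p) * p ^ card (A - {v}) + p * p ^ card (A - {v}) = p ^ card A"
    proof (cases "v \<in> A")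
      case True
      then have "Suc (card (A - {v})) = card A"
        using finite_subset[OF A] insert.hyps by (intro card_Suc_Diff1) auto
      then have "p * p ^ card (A - {v}) = p ^ card A" by (metis power_Suc)
      with True show ?thesis by simp
    qed (simp add: algebra_simps)
    finally show ?thesis .
  qed
  moreover have "0 \<le> q' S" for S using q(1) assms by (simp add: q'_def)
  ultimately show ?case by blast
qed

section \<open>Closed walks and cycles of the cube\<close>

text \<open>These are the direction words of closed walks: a walk returns to its start iff it flips
  every coordinate an even number of times.\<close>

definition even_words :: "nat \<Rightarrow> nat \<Rightarrow> nat list set" where
  "even_words d n = {ds. set ds \<subseteq> {..<d} \<and> length ds = n \<and> (\<forall>j. even (count_list ds j))}"

lemma finite_even_words: "finite (even_words d n)"
  by (rule finite_subset[OF _ finite_lists_length_eq[of "{..<d}" n]]) (auto simp: even_words_def)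

text \<open>The first letter \<open>c\<close> must occur again. Deleting it and one further
  occurrence leaves an even word, from which the old word is recovered by \<open>c\<close> and the
  place of that occurrence.\<close>

lemma card_even_words_step:
  "card (even_words d (Suc (Suc n))) \<le> d * (Suc n * card (even_words d n))"
proof -
  let ?f = "\<lambda>(c, k, ds). c # take k ds @ c # drop k ds"
  let ?X = "{..<d} \<times> {..n} \<times> even_words d n"
  have "even_words d (Suc (Suc n)) \<subseteq> ?f ` ?X"
  proof
    fix ds assume "ds \<in> even_words d (Suc (Suc n))"
    then have ds: "set ds \<subseteq> {..<d}" "length ds = Suc (Suc n)" "\<And>j. even (count_list ds j)"
      by (auto simp: even_words_def)
    obtain c es where es: "ds = c # es" using ds(2) by (cases ds) auto
    have "odd (count_list es c)" using ds(3)[of c] es by simp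
    then have "c \<in> set es" by (metis count_notin even_zero)
    then obtain xs ys where xy: "es = xs @ c # ys" by (meson split_list)
    have "even (count_list (xs @ ys) j)" for j
      using ds(3)[of j] es xy by (auto split: if_splits)
    then have "xs @ ys \<in> even_words d n" using ds es xy by (auto simp: even_words_def)
    moreover have "length xs \<le> n" "c < d" using ds es xy by auto
    ultimately have "(c, length xs, xs @ ys) \<in> ?X" by simp
    moreover have "ds = ?f (c, length xs, xs @ ys)" using es xy by simp
    ultimately show "ds \<in> ?f ` ?X" by (rule rev_image_eqI)
  qed
  then have "card (even_words d (Suc (Suc n))) \<le> card ?X"
    using finite_even_words by (intro surj_card_le) auto
  then show ?thesis by (simp add: card_cartesian_product)
qed

lemma card_even_words: "card (even_words d (2 * j)) \<le> (2 * j * d) ^ j"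
proof (induction j)
  case 0
  have "even_words d 0 \<subseteq> {[]}" by (auto simp: even_words_def)
  then have "card (even_words d 0) \<le> card {[] :: nat list}" by (intro card_mono) auto
  then show ?case by simp
next
  case (Suc j)
  have "card (even_words d (2 * Suc j)) \<le> d * (Suc (2 * j) * card (even_words d (2 * j)))"
    using card_even_words_step[of d "2 * j"] by simp
  also have "\<dots> \<le> d * (2 * Suc j * (2 * j * d) ^ j)"
    using Suc.IH by (intro mult_le_mono) auto
  also have "\<dots> \<le> d * (2 * Suc j * (2 * Suc j * d) ^ j)"
    by (intro mult_le_mono le_refl power_mono) auto
  also have "\<dots> = (2 * Suc j * d) ^ Suc j" by (simp only: power_Suc ac_simps)
  finally show ?case .
qed

text \<open>The end point \<open>fold flip ds u\<close> is left out, so a closed walk of length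
  \<open>n\<close> lists exactly \<open>n\<close> vertices.\<close>

fun walk :: "'a set \<Rightarrow> 'a list \<Rightarrow> 'a set list" where
  "walk u [] = []"
| "walk u (i # ds) = u # walk (flip i u) ds"

lemma length_walk [simp]: "length (walk u ds) = length ds"
  by (induction ds arbitrary: u) auto

lemma in_fold_flip: "j \<in> fold flip ds u \<longleftrightarrow> (j \<in> u) \<noteq> odd (count_list ds j)"
  by (induction ds arbitrary: u) (auto simp: in_flip)

text \<open>Directions are read off from consecutive vertices; \<open>z\<close> is the vertex
  reached after the last one, and \<open>z = hd xs\<close> is the case of a cycle.\<close>

lemma path_is_walk:
  assumes "xs \<noteq> []" "successively cube_adj xs" "cube_adj (last xs) z" "set xs \<subseteq> Pow D" "z \<subseteq> D"
  shows "\<exists>ds. set ds \<subseteq> D \<and> xs = walk (hd xs) ds \<and> fold flip ds (hd xs) = z"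
  using assms
proof (induction xs rule: induct_list012)
  case (2 x)
  then obtain i where i: "z = flip i x" by (auto simp: cube_adj_def)
  have "i \<in> x \<or> i \<in> z" using i by (simp add: in_flip)
  then have "i \<in> D" using 2 by auto
  then show ?case using i by (intro exI[of _ "[i]"]) simp
next
  case (3 x y xs)
  then obtain ds where ds: "set ds \<subseteq> D" "y # xs = walk y ds" "fold flip ds y = z" by auto
  obtain i where i: "y = flip i x" using 3 by (auto simp: cube_adj_def)
  have "i \<in> x \<or> i \<in> y" using i by (simp add: in_flip)
  then have "i \<in> D" using 3 by auto
  then show ?case using ds i by (intro exI[of _ "i # ds"]) simp
qed simp

text \<open>Every cycle appears once for each starting point and orientation, which is harmless in
  upper bounds.\<close>

definition cube_cycles :: "nat \<Rightarrow> nat \<Rightarrow> nat set list set" where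
  "cube_cycles d n = {xs. set xs \<subseteq> Pow {..<d} \<and> distinct xs \<and> successively cube_adj xs \<and>
     3 \<le> length xs \<and> cube_adj (last xs) (hd xs) \<and> length xs = n}"

lemma hd_cube_cycle:
  assumes "xs \<in> cube_cycles d n"
  shows "xs \<noteq> []" "hd xs \<in> Pow {..<d}"
proof -
  show "xs \<noteq> []" using assms by (auto simp: cube_cycles_def)
  then have "hd xs \<in> set xs" by simp
  then show "hd xs \<in> Pow {..<d}" using assms unfolding cube_cycles_def by blast
qed

lemma cube_cycle_word:
  assumes "xs \<in> cube_cycles d n"
  obtains ds where "ds \<in> even_words d n" "xs = walk (hd xs) ds"
proof -
  have xs: "xs \<noteq> []" "hd xs \<subseteq> {..<d}" "length xs = n"
    using assms hd_cube_cycle[OF assms] by (auto simp: cube_cycles_def)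
  obtain ds where ds: "set ds \<subseteq> {..<d}" "xs = walk (hd xs) ds" "fold flip ds (hd xs) = hd xs"
    using path_is_walk[of xs "hd xs" "{..<d}"] assms xs by (auto simp: cube_cycles_def)
  have "even (count_list ds j)" for j using ds(3) in_fold_flip[of j ds "hd xs"] by auto
  moreover have "length ds = n" using xs(3) ds(2) length_walk by metis
  ultimately show thesis using that ds by (auto simp: even_words_def)
qed

lemma cube_cycle_even:
  assumes "xs \<in> cube_cycles d n"
  shows "even n"
proof -
  obtain ds where ds: "ds \<in> even_words d n" using cube_cycle_word[OF assms] by blast
  then have "n = (\<Sum>j<d. count_list ds j)" by (auto simp: even_words_def sum_count_set)
  also have "even \<dots>" using ds by (intro dvd_sum) (auto simp: even_words_def)
  finally show ?thesis .
qed

lemma card_cube_cycles: "card (cube_cycles d (2 * j)) \<le> 2 ^ d * (2 * j * d) ^ j"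
proof -
  let ?X = "Pow {..<d} \<times> even_words d (2 * j)"
  have "cube_cycles d (2 * j) \<subseteq> (\<lambda>(u, ds). walk u ds) ` ?X"
  proof
    fix xs assume xs: "xs \<in> cube_cycles d (2 * j)"
    then obtain ds where "ds \<in> even_words d (2 * j)" "xs = walk (hd xs) ds" by (rule cube_cycle_word)
    moreover have "hd xs \<in> Pow {..<d}" using xs by (rule hd_cube_cycle)
    ultimately show "xs \<in> (\<lambda>(u, ds). walk u ds) ` ?X" by (intro rev_image_eqI[of "(hd xs, ds)"]) auto
  qed
  then have "card (cube_cycles d (2 * j)) \<le> card ?X"
    using finite_even_words by (intro surj_card_le) auto
  also have "\<dots> = 2 ^ d * card (even_words d (2 * j))" by (simp add: card_cartesian_product card_Pow)
  also have "\<dots> \<le> 2 ^ d * (2 * j * d) ^ j" using card_even_words by (rule mult_le_mono2)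
  finally show ?thesis .
qed

lemma finite_cube_cycles: "finite (cube_cycles d n)"
  by (rule finite_subset[OF _ finite_lists_length_eq[of "Pow {..<d}" n]]) (auto simp: cube_cycles_def)

abbreviation cube_deg :: "nat \<Rightarrow> nat set set \<Rightarrow> nat set \<Rightarrow> nat" where
  "cube_deg d S u \<equiv> card {i \<in> {..<d}. flip i u \<in> S}"

text \<open>Cycles of the cube have even length, so these are all those of length at most
  \<open>2 * R\<close>.\<close>

definition short_cycles :: "nat \<Rightarrow> nat \<Rightarrow> nat set list set" where
  "short_cycles d R = (\<Union>j\<in>{2..R}. cube_cycles d (2 * j))"

lemma finite_short_cycles: "finite (short_cycles d R)"
  by (simp add: short_cycles_def finite_cube_cycles)

lemma no_short_cycle_cubeI:
  assumes "V \<subseteq> Pow {..<d}" "\<And>xs. xs \<in> short_cycles d R \<Longrightarrow> \<not> set xs \<subseteq> V"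
  shows "no_short_cycle cube_adj V (2 * R)"
  unfolding no_short_cycle_def
proof (intro allI impI notI)
  fix xs assume xs: "set xs \<subseteq> V" "distinct xs" "successively cube_adj xs" "3 \<le> length xs"
    "length xs \<le> 2 * R" "cube_adj (last xs) (hd xs)"
  then have cyc: "xs \<in> cube_cycles d (length xs)" using assms(1) by (auto simp: cube_cycles_def)
  then obtain j where j: "length xs = 2 * j" using cube_cycle_even by (metis evenE)
  then have "xs \<in> short_cycles d R" using cyc xs(4,5) by (auto simp: short_cycles_def)
  then show False using assms(2) xs(1) by blast
qed

text \<open>Vertices of degree above \<open>\<Delta>\<close> are paid for by \<open>cher\<close>, the number of ordered paths of length two:
  each such vertex is the middle of at least \<open>\<Delta>\<close> times its degree of them.\<close>

lemma prune:
  fixes S :: "nat set set" and d R \<Delta> :: nat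
  assumes S: "S \<subseteq> Pow {..<d}"
  defines "cher \<equiv> card {(u, i, j). u \<in> Pow {..<d} \<and> i < d \<and> j < d \<and> i \<noteq> j \<and> {u, flip i u, flip j u} \<subseteq> S}"
    and "cyc \<equiv> card {xs \<in> short_cycles d R. set xs \<subseteq> S}"
  shows "\<exists>V\<subseteq>S. no_short_cycle cube_adj V (2 * R) \<and> (\<forall>u\<in>V. cube_deg d V u \<le> \<Delta>) \<and>
    \<Delta> * (\<Sum>u\<in>S. cube_deg d S u) \<le> \<Delta> * (\<Sum>u\<in>V. cube_deg d V u) + 2 * cher + 2 * \<Delta> * \<Delta> * cyc"
proof -
  have finS: "finite S" using S finite_subset by blast
  \<comment> \<open>The vertices to delete are those of too large degree and the first vertex of
    every short cycle.\<close>
  define B where "B = {u\<in>S. \<Delta> < cube_deg d S u}"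
  define C where "C = hd ` {xs \<in> short_cycles d R. set xs \<subseteq> S}"
  define V where "V = S - (B \<union> C)"
  have fins: "finite B" "finite C" "finite V"
    using finS finite_short_cycles by (auto simp: B_def C_def V_def)
  have CS: "C \<subseteq> S"
  proof
    fix u assume "u \<in> C"
    then obtain xs where xs: "xs \<in> short_cycles d R" "set xs \<subseteq> S" "u = hd xs" by (auto simp: C_def)
    then have "xs \<noteq> []" by (auto simp: short_cycles_def cube_cycles_def)
    then show "u \<in> S" using xs by (auto dest: hd_in_set)
  qed
  have cC: "card C \<le> cyc"
    unfolding C_def cyc_def using finite_short_cycles by (intro card_image_le) auto
  have short: "no_short_cycle cube_adj V (2 * R)"
  proof (rule no_short_cycle_cubeI)
    fix xs assume xs: "xs \<in> short_cycles d R"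
    then have "xs \<noteq> []" by (auto simp: short_cycles_def cube_cycles_def)
    then show "\<not> set xs \<subseteq> V" using xs by (auto simp: V_def C_def dest: hd_in_set)
  qed (use S in \<open>auto simp: V_def\<close>)
  have deg: "cube_deg d V u \<le> \<Delta>" if u: "u \<in> V" for u
  proof -
    have "cube_deg d V u \<le> cube_deg d S u" by (intro card_mono) (auto simp: V_def)
    then show ?thesis using u by (auto simp: V_def B_def)
  qed
  have heavy: "\<Delta> * (\<Sum>u\<in>B. cube_deg d S u) \<le> cher"
  proof -
    let ?T = "\<lambda>u. {i \<in> {..<d}. flip i u \<in> S}"
    have "\<Delta> * (\<Sum>u\<in>B. cube_deg d S u) \<le> (\<Sum>u\<in>B. card (?T u \<times> ?T u - Id_on (?T u)))"
      unfolding sum_distrib_left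
    proof (rule sum_mono)
      fix u assume u: "u \<in> B"
      have "card (Id_on (?T u)) = cube_deg d S u"
        by (rule bij_betw_same_card[of fst]) (auto simp: bij_betw_def inj_on_def Id_on_def image_iff)
      then have "card (?T u \<times> ?T u - Id_on (?T u)) = cube_deg d S u * cube_deg d S u - cube_deg d S u"
        by (subst card_Diff_subset) (auto simp: card_cartesian_product intro: finite_subset[of _ "?T u \<times> ?T u"])
      also have "\<dots> = (cube_deg d S u - 1) * cube_deg d S u" by (simp add: diff_mult_distrib)
      also have "\<dots> \<ge> \<Delta> * cube_deg d S u" using u by (intro mult_le_mono1) (auto simp: B_def)
      finally show "\<Delta> * cube_deg d S u \<le> card (?T u \<times> ?T u - Id_on (?T u))" .
    qed
    also have "\<dots> = card (SIGMA u:B. ?T u \<times> ?T u - Id_on (?T u))"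
      using fins by (intro card_SigmaI[symmetric]) auto
    also have "\<dots> \<le> cher" unfolding cher_def
    proof (rule card_mono)
      show "finite {(u, i, j). u \<in> Pow {..<d} \<and> i < d \<and> j < d \<and> i \<noteq> j \<and> {u, flip i u, flip j u} \<subseteq> S}"
        by (rule finite_subset[of _ "Pow {..<d} \<times> {..<d} \<times> {..<d}"]) auto
      show "(SIGMA u:B. ?T u \<times> ?T u - Id_on (?T u)) \<subseteq>
          {(u, i, j). u \<in> Pow {..<d} \<and> i < d \<and> j < d \<and> i \<noteq> j \<and> {u, flip i u, flip j u} \<subseteq> S}"
        using S by (auto simp: B_def)
    qed
    finally show ?thesis .
  qed
  have light: "(\<Sum>u\<in>B \<union> C. cube_deg d S u) \<le> (\<Sum>u\<in>B. cube_deg d S u) + \<Delta> * cyc"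
  proof -
    have "(\<Sum>u\<in>B \<union> C. cube_deg d S u) = (\<Sum>u\<in>B. cube_deg d S u) + (\<Sum>u\<in>C - B. cube_deg d S u)"
      using fins by (subst sum.union_disjoint[symmetric]) auto
    also have "(\<Sum>u\<in>C - B. cube_deg d S u) \<le> (\<Sum>u\<in>C - B. \<Delta>)"
      using CS by (intro sum_mono) (auto simp: B_def)
    also have "\<dots> \<le> \<Delta> * cyc"
      using cC card_mono[OF fins(2), of "C - B"] by (simp add: mult.commute)
    finally show ?thesis by simp
  qed
  \<comment> \<open>Every ordered adjacent pair that is lost has its first or its second vertex in
    \<open>B \<union> C\<close>, hence the factor 2.\<close>
  have lost: "(\<Sum>u\<in>S. cube_deg d S u) \<le> (\<Sum>u\<in>V. cube_deg d V u) + 2 * (\<Sum>u\<in>B \<union> C. cube_deg d S u)"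
  proof -
    let ?P = "SIGMA u:S. {i \<in> {..<d}. flip i u \<in> S}"
    let ?Q = "SIGMA u:V. {i \<in> {..<d}. flip i u \<in> V}"
    let ?X = "SIGMA u:B \<union> C. {i \<in> {..<d}. flip i u \<in> S}"
    let ?f = "\<lambda>(u, i). (flip i u, i)"
    have BCS: "B \<union> C \<subseteq> S" using CS by (auto simp: B_def)
    have "?P \<subseteq> ?Q \<union> (?X \<union> ?f ` ?X)"
    proof
      fix x assume x: "x \<in> ?P"
      then obtain u i where ui: "x = (u, i)" "u \<in> S" "i < d" "flip i u \<in> S" by auto
      have "x \<in> ?f ` ?X" if "flip i u \<in> B \<union> C"
        by (rule rev_image_eqI[of "(flip i u, i)"]) (use that ui in auto)
      then show "x \<in> ?Q \<union> (?X \<union> ?f ` ?X)" using ui by (auto simp: V_def)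
    qed
    moreover have finX: "finite ?X" using fins by auto
    moreover have "finite ?Q" using fins by auto
    ultimately have "card ?P \<le> card (?Q \<union> (?X \<union> ?f ` ?X))" by (intro card_mono) auto
    also have "\<dots> \<le> card ?Q + (card ?X + card (?f ` ?X))"
      by (meson add_le_mono card_Un_le le_refl le_trans)
    also have "card (?f ` ?X) \<le> card ?X" using finX by (rule card_image_le)
    finally have "card ?P \<le> card ?Q + 2 * card ?X" by simp
    moreover have "card ?P = (\<Sum>u\<in>S. cube_deg d S u)" "card ?Q = (\<Sum>u\<in>V. cube_deg d V u)"
      "card ?X = (\<Sum>u\<in>B \<union> C. cube_deg d S u)"
      using finS fins by (auto intro: card_SigmaI)
    ultimately show ?thesis by simp
  qed
  have "\<Delta> * (\<Sum>u\<in>S. cube_deg d S u) \<le>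
      \<Delta> * ((\<Sum>u\<in>V. cube_deg d V u) + 2 * ((\<Sum>u\<in>B. cube_deg d S u) + \<Delta> * cyc))"
    by (intro mult_le_mono2 le_trans[OF lost] add_left_mono light)
  also have "\<dots> = \<Delta> * (\<Sum>u\<in>V. cube_deg d V u) + 2 * (\<Delta> * (\<Sum>u\<in>B. cube_deg d S u)) + 2 * \<Delta> * \<Delta> * cyc"
    by (simp add: algebra_simps)
  also have "\<dots> \<le> \<Delta> * (\<Sum>u\<in>V. cube_deg d V u) + 2 * cher + 2 * \<Delta> * \<Delta> * cyc"
    using heavy by simp
  finally have "\<Delta> * (\<Sum>u\<in>S. cube_deg d S u) \<le> \<Delta> * (\<Sum>u\<in>V. cube_deg d V u) + 2 * cher + 2 * \<Delta> * \<Delta> * cyc" .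
  then show ?thesis using short deg by (intro exI[of _ V]) (auto simp: V_def)
qed

section \<open>Expectations and the deletion method\<close>

text \<open>Linearity of expectation, with the weights \<open>q\<close> in place of a probability
  measure.\<close>

lemma expected_count:
  fixes q :: "'a set \<Rightarrow> real"
  assumes q: "\<And>A. A \<subseteq> D \<Longrightarrow> (\<Sum>S\<in>Pow D. if A \<subseteq> S then q S else 0) = p ^ card A"
    and "finite X" "\<And>x. x \<in> X \<Longrightarrow> A x \<subseteq> D"
  shows "(\<Sum>S\<in>Pow D. q S * real (card {x\<in>X. A x \<subseteq> S})) = (\<Sum>x\<in>X. p ^ card (A x))"
proof -
  have "(\<Sum>S\<in>Pow D. q S * real (card {x\<in>X. A x \<subseteq> S})) =
      (\<Sum>S\<in>Pow D. \<Sum>x\<in>X. if A x \<subseteq> S then q S else 0)"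
    using assms(2) by (simp add: card_filter_sum sum_distrib_left if_distrib mult.commute cong: if_cong)
  also have "\<dots> = (\<Sum>x\<in>X. \<Sum>S\<in>Pow D. if A x \<subseteq> S then q S else 0)" by (rule sum.swap)
  also have "\<dots> = (\<Sum>x\<in>X. p ^ card (A x))" using q assms(3) by (intro sum.cong) auto
  finally show ?thesis .
qed

text \<open>This bounds the expected number of short cycles. Those of length \<open>2 * j\<close>
  contribute at most \<open>2 ^ d * z ^ j\<close> with \<open>z = 2 * R * d * p\<^sup>2\<close>, and
  since \<open>z \<le> 1\<close> the worst case is \<open>j = 2\<close>.\<close>

lemma cube_cycles_weight:
  fixes p :: real
  assumes p: "0 \<le> p" and z: "2 * real R * real d * p\<^sup>2 \<le> 1"
  shows "(\<Sum>xs\<in>short_cycles d R. p ^ card (set xs)) \<le> 2 ^ d * (real R * (2 * real R * real d * p\<^sup>2)\<^sup>2)"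
proof -
  let ?z = "2 * real R * real d * p\<^sup>2"
  have level: "(\<Sum>xs\<in>cube_cycles d (2 * j). p ^ card (set xs)) \<le> 2 ^ d * ?z\<^sup>2" if j: "j \<in> {2..R}" for j
  proof -
    have "(\<Sum>xs\<in>cube_cycles d (2 * j). p ^ card (set xs)) = (\<Sum>xs\<in>cube_cycles d (2 * j). p ^ (2 * j))"
      by (intro sum.cong) (auto simp: cube_cycles_def distinct_card)
    also have "\<dots> = real (card (cube_cycles d (2 * j))) * p ^ (2 * j)" by simp
    also have "\<dots> \<le> real (2 ^ d * (2 * j * d) ^ j) * p ^ (2 * j)"
      using card_cube_cycles p by (intro mult_right_mono of_nat_mono) auto
    also have "\<dots> = 2 ^ d * (2 * real j * real d * p\<^sup>2) ^ j"
      by (simp add: power_mult_distrib power_mult)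
    also have "\<dots> \<le> 2 ^ d * ?z ^ j"
      using j p by (intro mult_left_mono power_mono mult_right_mono) auto
    also have "\<dots> \<le> 2 ^ d * ?z\<^sup>2"
      using j p z by (intro mult_left_mono power_decreasing) auto
    finally show ?thesis .
  qed
  have "(\<Sum>xs\<in>short_cycles d R. p ^ card (set xs)) =
      (\<Sum>j\<in>{2..R}. \<Sum>xs\<in>cube_cycles d (2 * j). p ^ card (set xs))"
    unfolding short_cycles_def
    by (rule sum.UNION_disjoint) (simp_all add: finite_cube_cycles, auto simp: cube_cycles_def)
  also have "\<dots> \<le> (\<Sum>j\<in>{2..R}. 2 ^ d * ?z\<^sup>2)" using level by (rule sum_mono)
  also have "\<dots> = real (card {2..R}) * (2 ^ d * ?z\<^sup>2)" by simp
  also have "\<dots> \<le> real R * (2 ^ d * ?z\<^sup>2)" by (intro mult_right_mono) auto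
  finally show ?thesis by (simp add: ac_simps)
qed

text \<open>Deletion method: in a random set of density \<open>p\<close>, the expected degree sum
  exceeds the expected losses of \<open>prune\<close> plus the required density, so some outcome is
  still dense after pruning.\<close>

lemma sparse_cube_subset:
  assumes K: "K \<ge> 1" and R: "R \<ge> 1" and d: "128 * (8 * K) ^ 3 * R ^ 3 < d"
  shows "\<exists>V\<subseteq>Pow {..<d}. no_short_cycle cube_adj V (2 * R) \<and> (\<forall>u\<in>V. cube_deg d V u \<le> 32 * K) \<and>
    2 * K * card V < (\<Sum>u\<in>V. cube_deg d V u)"
proof -
  \<comment> \<open>\<open>\<kappa> = d * p\<close> is about the average degree of the random set,
    and \<open>\<Delta> = 4 * \<kappa>\<close>. In units of \<open>N * p * \<kappa>\<^sup>2\<close>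
    the degree sum times \<Delta> is worth 4, paths of length two cost 2 and the required density
    costs 1, which leaves 1 for the cycles.\<close>
  define \<kappa> where "\<kappa> = 8 * real K"
  define r where "r = real R"
  define N where "N = (2::real) ^ d"
  define p where "p = \<kappa> / real d"
  define \<Delta> where "\<Delta> = 32 * K"
  let ?D = "Pow {..<d}"
  have \<kappa>: "\<kappa> \<ge> 8" and r: "r \<ge> 1" and N: "N > 0" using K R by (auto simp: \<kappa>_def r_def N_def)
  have dr: "128 * \<kappa> ^ 3 * r ^ 3 < real d"
    using d unfolding \<kappa>_def r_def by (metis (mono_tags, lifting) of_nat_less_iff of_nat_mult of_nat_numeral of_nat_power)
  have d0: "real d > 0" using dr \<kappa> r by (smt (verit) mult_nonneg_nonneg zero_le_power)
  have dp: "real d * p = \<kappa>" using d0 by (simp add: p_def)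
  have p0: "p > 0" using \<kappa> d0 by (simp add: p_def)
  \<comment> \<open>This is the lower bound on \<open>d\<close>, rewritten through
    \<open>p = \<kappa> / d\<close>; it keeps the cost of the cycles below the part left for
    them.\<close>
  have small: "128 * \<kappa>\<^sup>2 * r ^ 3 * p < 1"
  proof -
    have "128 * \<kappa>\<^sup>2 * r ^ 3 * p * real d = 128 * \<kappa> ^ 3 * r ^ 3"
      using dp by (simp add: power2_eq_square power3_eq_cube mult.assoc mult.commute[of p])
    then show ?thesis using dr d0 by (metis mult.left_neutral mult_less_cancel_right_pos)
  qed
  have r3: "r \<le> r ^ 3" using r by (metis power_increasing power_one_right numeral_One one_le_numeral)
  have \<kappa>2: "1 \<le> \<kappa>\<^sup>2" "\<kappa> \<le> \<kappa>\<^sup>2" using \<kappa> by (auto simp: power2_eq_square intro: order_trans[of 1 \<kappa>])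
  have "1 * 1 * 1 * p \<le> 128 * \<kappa>\<^sup>2 * r ^ 3 * p"
    using \<kappa>2 r r3 p0 by (intro mult_right_mono mult_mono) auto
  then have p1: "p \<le> 1" using small by simp
  have z_eq: "2 * real R * real d * p\<^sup>2 = 2 * r * \<kappa> * p"
    using dp by (simp add: r_def power2_eq_square mult.assoc)
  have "2 * \<kappa> * r * p \<le> 128 * \<kappa>\<^sup>2 * r ^ 3 * p"
    using \<kappa> \<kappa>2 r r3 p0 by (intro mult_right_mono mult_mono) auto
  then have z: "2 * real R * real d * p\<^sup>2 \<le> 1" unfolding z_eq using small by (simp add: ac_simps)
  obtain q where q: "\<And>S. 0 \<le> q S"
    "\<And>A. A \<subseteq> ?D \<Longrightarrow> (\<Sum>S\<in>Pow ?D. if A \<subseteq> S then q S else 0) = p ^ card A"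
    using random_subset_weights[of ?D p] p0 p1 by auto
  define ex where "ex f = (\<Sum>S\<in>Pow ?D. q S * f S)" for f :: "nat set set \<Rightarrow> real"
  define deg where "deg S = (\<Sum>u\<in>S. cube_deg d S u)" for S
  define cher where "cher S = card {(u, i, j). u \<in> ?D \<and> i < d \<and> j < d \<and> i \<noteq> j \<and> {u, flip i u, flip j u} \<subseteq> S}" for S
  define cyc where "cyc S = card {xs \<in> short_cycles d R. set xs \<subseteq> S}" for S
  have fl: "flip i u \<in> ?D" if "u \<in> ?D" "i < d" for i u using that by (auto simp: flip_def)
  have ne: "flip i u \<noteq> u" "u \<noteq> flip i u" for i :: nat and u by (metis in_flip)+
  have c2: "card {u, flip i u} = 2" for i :: nat and u using ne(2)[of u i] by simp
  have ex_card: "ex (\<lambda>S. real (card S)) = N * p"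
  proof -
    have "ex (\<lambda>S. real (card S)) = (\<Sum>S\<in>Pow ?D. q S * real (card {u\<in>?D. {u} \<subseteq> S}))"
      unfolding ex_def by (intro sum.cong refl arg_cong2[of _ _ _ _ "(*)"] arg_cong[of _ _ real] arg_cong[of _ _ card]) auto
    also have "\<dots> = (\<Sum>u\<in>?D. p ^ card {u})" by (intro expected_count q(2)) auto
    finally show ?thesis by (simp add: N_def card_Pow)
  qed
  have ex_deg: "ex (\<lambda>S. real (deg S)) = N * \<kappa> * p"
  proof -
    let ?A = "\<lambda>(u, i). {u, flip i u}"
    have "deg S = card {x\<in>?D \<times> {..<d}. ?A x \<subseteq> S}" if "S \<in> Pow ?D" for S
    proof -
      have "deg S = card (SIGMA u:S. {i \<in> {..<d}. flip i u \<in> S})"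
        unfolding deg_def using that finite_subset[of S ?D] by (intro card_SigmaI[symmetric]) auto
      also have "(SIGMA u:S. {i \<in> {..<d}. flip i u \<in> S}) = {x\<in>?D \<times> {..<d}. ?A x \<subseteq> S}" using that by auto
      finally show ?thesis .
    qed
    then have "ex (\<lambda>S. real (deg S)) = (\<Sum>S\<in>Pow ?D. q S * real (card {x\<in>?D \<times> {..<d}. ?A x \<subseteq> S}))"
      unfolding ex_def by (intro sum.cong) auto
    also have "\<dots> = (\<Sum>x\<in>?D \<times> {..<d}. p ^ card (?A x))"
      using fl by (intro expected_count q(2)) auto
    also have "\<dots> = (\<Sum>x\<in>?D \<times> {..<d}. p\<^sup>2)"
      using c2 by (intro sum.cong refl) auto
    also have "\<dots> = N * (real d * p) * p"
      by (simp add: N_def card_Pow card_cartesian_product power2_eq_square)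
    finally show ?thesis by (simp add: dp)
  qed
  have ex_cher: "ex (\<lambda>S. real (cher S)) \<le> N * \<kappa>\<^sup>2 * p"
  proof -
    let ?A = "\<lambda>(u, i, j). {u, flip i u, flip j u}"
    let ?X = "{(u, i, j). u \<in> ?D \<and> i < d \<and> j < d \<and> i \<noteq> j}"
    have sub: "?X \<subseteq> ?D \<times> {..<d} \<times> {..<d}" by auto
    have finX: "finite ?X" by (rule finite_subset[OF sub]) auto
    have "cher S = card {x\<in>?X. ?A x \<subseteq> S}" for S
      unfolding cher_def by (intro arg_cong[of _ _ card]) auto
    then have "ex (\<lambda>S. real (cher S)) = (\<Sum>S\<in>Pow ?D. q S * real (card {x\<in>?X. ?A x \<subseteq> S}))"
      unfolding ex_def by simp
    also have "\<dots> = (\<Sum>x\<in>?X. p ^ card (?A x))"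
      using fl finX by (intro expected_count q(2)) auto
    also have "\<dots> = (\<Sum>x\<in>?X. p ^ 3)"
    proof (rule sum.cong)
      fix x assume "x \<in> ?X"
      then obtain u i j where x: "x = (u, i, j)" "i \<noteq> j" by auto
      have "card {u, flip i u, flip j u} = 3"
        using x(2) ne(2)[of u i] ne(2)[of u j] by (simp add: flip_eq_iff)
      then show "p ^ card (?A x) = p ^ 3" using x by simp
    qed simp
    also have "\<dots> = real (card ?X) * p ^ 3" by simp
    also have "\<dots> \<le> real (card (?D \<times> {..<d} \<times> {..<d})) * p ^ 3"
      using p0 sub by (intro mult_right_mono of_nat_mono card_mono) auto
    also have "\<dots> = N * (real d * p)\<^sup>2 * p"
      by (simp add: N_def card_Pow card_cartesian_product power2_eq_square power3_eq_cube)
    finally show ?thesis by (simp add: dp)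
  qed
  have ex_cyc: "ex (\<lambda>S. real (cyc S)) \<le> N * (4 * r ^ 3 * \<kappa>\<^sup>2 * p\<^sup>2)"
  proof -
    have "ex (\<lambda>S. real (cyc S)) = (\<Sum>xs\<in>short_cycles d R. p ^ card (set xs))"
      unfolding ex_def cyc_def
      by (intro expected_count q(2) finite_short_cycles) (auto simp: short_cycles_def cube_cycles_def)
    also have "\<dots> \<le> N * (r * (2 * r * \<kappa> * p)\<^sup>2)"
      using cube_cycles_weight[OF less_imp_le[OF p0] z] unfolding z_eq N_def r_def .
    also have "\<dots> = N * (4 * r ^ 3 * \<kappa>\<^sup>2 * p\<^sup>2)"
      by (simp add: power_mult_distrib power2_eq_square power3_eq_cube)
    finally show ?thesis .
  qed
  \<comment> \<open>A positive \<open>\<Phi> S\<close> means that even after pruning the degree sum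
    is above \<open>2 * K * card S\<close>.\<close>
  define \<Phi> where "\<Phi> S = real \<Delta> * real (deg S) - 2 * real (cher S) - 2 * (real \<Delta>)\<^sup>2 * real (cyc S)
    - 2 * real \<Delta> * real K * real (card S)" for S
  have \<Delta>: "real \<Delta> = 4 * \<kappa>" and K8: "real K = \<kappa> / 8" by (simp_all add: \<Delta>_def \<kappa>_def)
  have "ex \<Phi> = real \<Delta> * ex (\<lambda>S. real (deg S)) - 2 * ex (\<lambda>S. real (cher S))
      - 2 * (real \<Delta>)\<^sup>2 * ex (\<lambda>S. real (cyc S)) - 2 * real \<Delta> * real K * ex (\<lambda>S. real (card S))"
    unfolding ex_def \<Phi>_def by (simp add: algebra_simps sum.distrib sum_subtractf sum_distrib_left)
  also have "\<dots> \<ge> real \<Delta> * (N * \<kappa> * p) - 2 * (N * \<kappa>\<^sup>2 * p)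
      - 2 * (real \<Delta>)\<^sup>2 * (N * (4 * r ^ 3 * \<kappa>\<^sup>2 * p\<^sup>2)) - 2 * real \<Delta> * real K * (N * p)"
    unfolding ex_deg ex_card using ex_cher ex_cyc
    by (intro diff_mono mult_left_mono order_refl) auto
  also have "real \<Delta> * (N * \<kappa> * p) - 2 * (N * \<kappa>\<^sup>2 * p)
      - 2 * (real \<Delta>)\<^sup>2 * (N * (4 * r ^ 3 * \<kappa>\<^sup>2 * p\<^sup>2)) - 2 * real \<Delta> * real K * (N * p)
      = N * p * \<kappa>\<^sup>2 * (1 - 128 * \<kappa>\<^sup>2 * r ^ 3 * p)"
    unfolding \<Delta> K8 by (simp add: algebra_simps power2_eq_square power3_eq_cube)
  finally have "N * p * \<kappa>\<^sup>2 * (1 - 128 * \<kappa>\<^sup>2 * r ^ 3 * p) \<le> ex \<Phi>" .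
  moreover have "0 < N * p * \<kappa>\<^sup>2 * (1 - 128 * \<kappa>\<^sup>2 * r ^ 3 * p)"
    using N p0 \<kappa> small by (intro mult_pos_pos) auto
  ultimately have "0 < ex \<Phi>" by linarith
  then have "\<exists>S\<in>Pow ?D. 0 < \<Phi> S"
    unfolding ex_def using q(1) by (meson mult_nonneg_nonpos not_le sum_nonpos)
  then obtain S where S: "S \<subseteq> ?D" "0 < \<Phi> S" by auto
  obtain V where V: "V \<subseteq> S" "no_short_cycle cube_adj V (2 * R)" "\<forall>u\<in>V. cube_deg d V u \<le> \<Delta>"
    "\<Delta> * deg S \<le> \<Delta> * deg V + 2 * cher S + 2 * \<Delta> * \<Delta> * cyc S"
    using prune[OF S(1), of R \<Delta>] unfolding deg_def cher_def cyc_def by blast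
  have "card V \<le> card S" using V(1) S(1) finite_subset[of S ?D] by (intro card_mono) auto
  have "real (\<Delta> * deg S) \<le> real (\<Delta> * deg V + 2 * cher S + 2 * \<Delta> * \<Delta> * cyc S)"
    using V(4) by (rule of_nat_mono)
  with S(2) have "2 * real \<Delta> * real K * real (card S) < real \<Delta> * real (deg V)"
    unfolding \<Phi>_def by (simp add: power2_eq_square)
  then have "real (\<Delta> * (2 * K * card S)) < real (\<Delta> * deg V)" by (simp add: ac_simps)
  then have "\<Delta> * (2 * K * card S) < \<Delta> * deg V" by (simp only: of_nat_less_iff)
  then have "2 * K * card S < deg V" by simp
  moreover have "2 * K * card V \<le> 2 * K * card S" using \<open>card V \<le> card S\<close> by simp
  ultimately have "2 * K * card V < deg V" by (rule le_less_trans[rotated])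
  then show ?thesis using V S unfolding deg_def \<Delta>_def by (intro exI[of _ V]) auto
qed

section \<open>The hereditary family\<close>

lemma log2_ge_chord:
  assumes "1 \<le> y" "y \<le> 2"
  shows "y - 1 \<le> log 2 (y::real)"
proof -
  have "(1 - (y - 1)) * log 2 1 + (y - 1) * log 2 2 \<le> log 2 ((1 - (y - 1)) *\<^sub>R 1 + (y - 1) *\<^sub>R 2)"
    using assms by (intro concave_onD[OF log_concave]) auto
  then show ?thesis by (simp add: algebra_simps)
qed

text \<open>On each dyadic interval the concave logarithm is replaced by its chord, which turns the
  claim into a quadratic inequality in \<open>y = x / 2 ^ k\<close>.\<close>

lemma half_le_log2_square:
  assumes "2 \<le> x" "x \<le> 64"
  shows "x / 2 \<le> (log 2 (x::real))\<^sup>2"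
proof -
  have piece: "x / 2 \<le> (log 2 x)\<^sup>2"
    if k: "2 ^ k \<le> x" "x \<le> 2 * 2 ^ k" "k \<ge> 1"
      and q: "\<And>y::real. 1 \<le> y \<Longrightarrow> 2 ^ k / 2 * y \<le> (real k - 1 + y)\<^sup>2" for k :: nat
  proof -
    define y where "y = x / 2 ^ k"
    have y: "1 \<le> y" "y \<le> 2" "x = 2 ^ k * y" using k by (auto simp: y_def field_simps)
    have "log 2 x = real k + log 2 y" using y by (simp add: log_mult log_nat_power)
    then have "real k - 1 + y \<le> log 2 x" using log2_ge_chord[OF y(1,2)] by simp
    then have "(real k - 1 + y)\<^sup>2 \<le> (log 2 x)\<^sup>2" using k(3) y(1) by (intro power_mono) auto
    then show ?thesis using q[OF y(1)] y(3) by simp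
  qed
  have sq: "0 \<le> (y - c)\<^sup>2" for y c :: real by simp
  consider "x \<le> 4" | "4 \<le> x" "x \<le> 8" | "8 \<le> x" "x \<le> 16" | "16 \<le> x" "x \<le> 32" | "32 \<le> x" by linarith
  then show ?thesis
  proof cases
    case 1
    then show ?thesis using assms by (intro piece[of 1]) (auto simp: power2_eq_square)
  next
    case 2
    show ?thesis by (rule piece[of 2]) (use 2 in \<open>auto simp: power2_eq_square algebra_simps\<close>)
  next
    case 3
    show ?thesis by (rule piece[of 3]) (use 3 in \<open>auto simp: power2_eq_square algebra_simps\<close>)
  next
    case 4
    have "8 * y \<le> (3 + y)\<^sup>2" for y :: real using sq[of y 1] by (simp add: power2_eq_square algebra_simps)
    then show ?thesis using 4 by (intro piece[of 4]) auto
  next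
    case 5
    have "16 * y \<le> (4 + y)\<^sup>2" for y :: real using sq[of y 4] by (simp add: power2_eq_square algebra_simps)
    then show ?thesis using 5 assms by (intro piece[of 5]) auto
  qed
qed

lemma sep_bound_ge:
  assumes "c \<le> (log 2 (log 2 (real m)))\<^sup>2" "m \<ge> 2"
  shows "real m / log 2 (real m) * c \<le> sep_bound m"
  unfolding sep_bound_def using assms by (intro mult_left_mono) auto

text \<open>The factor \<open>2304 = 18 \<cdot> 128\<close> comes from \<open>x \<le> 18 s D\<close> and \<open>4 \<Delta> = 128 K\<close> in the last case.\<close>

lemma cube_sep_bound:
  assumes K: "K \<ge> 1" and s: "s = 2304 * K"
    and V: "V \<subseteq> Pow {..<2 ^ (8 * s)}" "no_short_cycle cube_adj V (2 * 2 ^ (2 * s))"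
    and deg: "\<forall>u\<in>V. cube_deg (2 ^ (8 * s)) V u \<le> 32 * K"
    and W: "W \<subseteq> V" and m: "card W \<ge> 4"
  shows "\<exists>S. balanced_sep cube_adj W S \<and> real (card S) \<le> sep_bound (card W)"
proof -
  let ?m = "card W"
  define x where "x = log 2 (real ?m)"
  have finW: "finite W" using m by (intro card_ge_0_finite) auto
  have mx: "real ?m = 2 powr x" using m by (simp add: x_def)
  have four: "log 2 4 = (2::real)" using log_nat_power[of 2 2 2] by simp
  have "log 2 4 \<le> x" unfolding x_def using m by simp
  then have x2: "2 \<le> x" by (simp only: four)
  \<comment> \<open>Up to \<open>x = 2 ^ s\<close> the girth covers balls of radius below
    \<open>n\<^sup>2\<close> for \<open>n = \<lceil>x\<rceil>\<close>; beyond it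
    \<open>log 2 x\<close> exceeds \<open>s\<close>, which outweighs the degree bound
    \<open>32 * K\<close>.\<close>
  consider (tiny) "x \<le> 64" | (small) "64 < x" "x \<le> 2 ^ s" | (large) "64 < x" "2 ^ s < x" by linarith
  then show ?thesis
  proof cases
    case tiny
    obtain S where S: "balanced_sep cube_adj W S" "card S = (?m + 2) div 3"
      using balanced_sep_third[OF finW] by blast
    \<comment> \<open>A third of \<open>?m\<close>, rounded up, is at most half of \<open>?m\<close>
      because \<open>?m \<ge> 4\<close>.\<close>
    have "2 * ((?m + 2) div 3) \<le> ?m" using m by linarith
    then have "real (card S) \<le> real ?m / 2" using S(2) by linarith
    also have "\<dots> = real ?m / x * (x / 2)" using x2 by simp
    also have "\<dots> \<le> sep_bound ?m"
      unfolding x_def using half_le_log2_square[OF x2 tiny] m by (intro sep_bound_ge) (auto simp: x_def)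
    finally show ?thesis using S(1) by blast
  next
    case small
    define n where "n = nat \<lceil>x\<rceil>"
    have n: "x \<le> real n" "real n < x + 1" using x2 unfolding n_def by linarith+
    have "real n \<le> 2 ^ s"
    proof -
      have "\<lceil>x\<rceil> \<le> 2 ^ s" using small(2) by (simp add: ceiling_le_iff)
      then have "int n \<le> 2 ^ s" using x2 by (simp add: n_def)
      then show ?thesis by (metis of_int_le_iff of_int_numeral of_int_of_nat_eq of_int_power)
    qed
    then have "n \<le> 2 ^ s" by (metis of_nat_le_iff of_nat_numeral of_nat_power)
    then have "n\<^sup>2 \<le> 2 ^ (2 * s)" by (metis power_mono power_mult mult.commute zero_le)
    moreover have "real ?m \<le> 2 powr real n" unfolding mx using n by simp
    then have "?m \<le> 2 ^ n" by (simp add: powr_realpow)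
    moreover have "n \<ge> 1" using n x2 by linarith
    ultimately obtain S where S: "balanced_sep cube_adj W S" "real (card S) \<le> real ?m / real n + 1"
      using high_girth_separator[where E = cube_adj and c = "\<lambda>u. even (card u)",
          OF cube_adj_sym cube_adj_parity _ finW, of n] no_short_cycle_subset[OF V(2) W, of "2 * n\<^sup>2"]
      by auto
    \<comment> \<open>This absorbs the extra centroid vertex, as
      \<open>1 \<le> ?m / x\<close>.\<close>
    have "x \<le> real ?m"
    proof -
      have "n - 1 < 2 ^ (n - 1)" by (rule less_exp)
      then have "n \<le> 2 ^ (n - 1)" by linarith
      then have "real n \<le> 2 powr real (n - 1)" by (simp add: powr_realpow)
      also have "\<dots> \<le> 2 powr x" using n \<open>n \<ge> 1\<close> by simp
      finally show ?thesis using n mx by simp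
    qed
    then have "1 \<le> real ?m / x" using x2 by simp
    moreover have "real ?m / real n \<le> real ?m / x" using n x2 by (intro divide_left_mono) auto
    ultimately have "real (card S) \<le> real ?m / x * 2" using S(2) by linarith
    also have "\<dots> \<le> sep_bound ?m" unfolding x_def
    proof (rule sep_bound_ge)
      have "log 2 4 \<le> log 2 x" using small(1) by (subst log_le_cancel_iff) auto
      then have "2 \<le> log 2 x" by (simp only: four)
      then have "2 * 2 \<le> log 2 x * log 2 x" by (intro mult_mono) auto
      then show "2 \<le> (log 2 (log 2 (real ?m)))\<^sup>2" by (simp add: x_def power2_eq_square)
    qed (use m in auto)
    finally show ?thesis using S(1) by blast
  next
    case large
    \<comment> \<open>Chosen so that \<open>(2 ^ (8 * s) + 1) ^ D \<le> ?m / 4\<close>, with each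
      factor estimated by \<open>2 ^ (8 * s + 1)\<close>.\<close>
    define D where "D = nat \<lfloor>(x - 2) / (8 * real s + 1)\<rfloor>"
    have s1: "real s \<ge> 8" using K s by simp
    have "s \<ge> 8" using s K by simp
    then have "16 * s + 6 \<le> 2 ^ s" by (induction s rule: nat_induct_at_least) auto
    then have "16 * real s + 6 \<le> 2 ^ s"
      by (metis (mono_tags, lifting) of_nat_add of_nat_le_iff of_nat_mult of_nat_numeral of_nat_power)
    then have xs: "16 * real s + 6 \<le> x" using large by linarith
    have D_le: "real D * (8 * real s + 1) \<le> x - 2"
    proof -
      have "real D \<le> (x - 2) / (8 * real s + 1)" unfolding D_def using x2 by simp
      then show ?thesis by (simp add: field_simps)
    qed
    have D_ge: "x \<le> 18 * real s * real D"
    proof -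
      have "(x - 2) / (8 * real s + 1) < real D + 1" unfolding D_def by linarith
      then have "x - 2 < (real D + 1) * (8 * real s + 1)" by (simp add: field_simps)
      \<comment> \<open>The rounding in \<open>D\<close> and the \<open>2\<close> lose at most
        \<open>8 * s + 3\<close>, which by \<open>xs\<close> is at most half of
        \<open>x\<close>.\<close>
      then have "x \<le> 2 * (8 * real s + 1) * real D" using xs by (simp add: algebra_simps)
      also have "\<dots> \<le> 18 * real s * real D" using s1 by (intro mult_right_mono) auto
      finally show ?thesis .
    qed
    have D1: "D \<ge> 1"
    proof (rule ccontr)
      assume "\<not> D \<ge> 1"
      then have "D = 0" by simp
      then show False using D_ge x2 by simp
    qed
    have "3 * (2 ^ (8 * s) + 1) ^ D \<le> ?m"
    proof -
      have "real (2 ^ (8 * s) + 1) \<le> 2 ^ (8 * s + 1)" by simp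
      then have "real ((2 ^ (8 * s) + 1) ^ D) \<le> (2 ^ (8 * s + 1)) ^ D"
        unfolding of_nat_power by (rule power_mono) simp
      also have "\<dots> = 2 ^ (D * (8 * s + 1))" by (metis power_mult mult.commute)
      also have "\<dots> = 2 powr real (D * (8 * s + 1))" by (rule powr_realpow[symmetric]) simp
      also have "\<dots> \<le> 2 powr (x - 2)" using D_le by (simp add: distrib_left)
      also have "\<dots> = real ?m / 4" unfolding mx by (simp add: powr_diff)
      finally have "real (4 * (2 ^ (8 * s) + 1) ^ D) \<le> real ?m" by simp
      then have "4 * (2 ^ (8 * s) + 1) ^ D \<le> ?m" by (simp only: of_nat_le_iff)
      then show ?thesis by linarith
    qed
    moreover have "cube_deg (2 ^ (8 * s)) W u \<le> 32 * K" if "u \<in> W" for u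
    proof -
      have "cube_deg (2 ^ (8 * s)) W u \<le> cube_deg (2 ^ (8 * s)) V u" using W by (intro card_mono) auto
      also have "\<dots> \<le> 32 * K" using deg W that by blast
      finally show ?thesis .
    qed
    moreover have "W \<subseteq> Pow {..<2 ^ (8 * s)}" using W V(1) by blast
    ultimately obtain S where S: "balanced_sep cube_adj W S"
      "real (card S) \<le> 4 * real (32 * K) / real D * real ?m"
      using cube_separator[of W "2 ^ (8 * s)" D "32 * K"] D1 by blast
    have "4 * real (32 * K) / real D \<le> (real s)\<^sup>2 / x"
    proof -
      have "4 * real (32 * K) * x \<le> 4 * real (32 * K) * (18 * real s * real D)"
        using D_ge by (intro mult_left_mono) auto
      also have "\<dots> = (real s)\<^sup>2 * real D" by (simp add: s power2_eq_square)
      finally show ?thesis using D1 x2 by (simp add: field_simps)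
    qed
    then have "real (card S) \<le> (real s)\<^sup>2 / x * real ?m"
      using S(2) by (meson mult_right_mono of_nat_0_le_iff order_trans)
    also have "\<dots> = real ?m / x * (real s)\<^sup>2" by simp
    also have "\<dots> \<le> sep_bound ?m" unfolding x_def
    proof (rule sep_bound_ge)
      have "log 2 (2 ^ s) \<le> log 2 x" using large x2 by (subst log_le_cancel_iff) auto
      then have "real s \<le> log 2 x" by (simp add: log_nat_power)
      then show "(real s)\<^sup>2 \<le> (log 2 (log 2 (real ?m)))\<^sup>2" by (auto simp: x_def intro: power_mono)
    qed (use m in auto)
    finally show ?thesis using S(1) by blast
  qed
qed

section \<open>Transfer to graphs on the natural numbers\<close>

text \<open>\<open>set_encode\<close> is injective on finite sets and brings all members of the
  family to the vertex type \<open>nat\<close>.\<close>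

definition cube_graph :: "nat set set \<Rightarrow> nat graph" where
  "cube_graph V = (set_encode ` V, {{set_encode u, set_encode v} |u v. u \<in> V \<and> v \<in> V \<and> cube_adj u v})"

lemma cube_adj_irrefl: "\<not> cube_adj u u"
  using cube_adj_parity by blast

lemma inj_set_encode: "V \<subseteq> Collect finite \<Longrightarrow> inj_on set_encode V"
  by (rule inj_on_subset[OF inj_on_set_encode])

lemma cube_graph_edge_iff:
  assumes V: "V \<subseteq> Collect finite" and "u \<in> V" "v \<in> V"
  shows "{set_encode u, set_encode v} \<in> edges (cube_graph V) \<longleftrightarrow> cube_adj u v"
proof
  assume "{set_encode u, set_encode v} \<in> edges (cube_graph V)"
  then obtain a b where ab: "a \<in> V" "b \<in> V" "cube_adj a b" "{set_encode u, set_encode v} = {set_encode a, set_encode b}"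
    by (auto simp: cube_graph_def)
  then have "u = a \<and> v = b \<or> u = b \<and> v = a"
    using inj_onD[OF inj_set_encode[OF V]] assms(2,3) by (auto simp: doubleton_eq_iff)
  then show "cube_adj u v" using ab(3) cube_adj_sym by blast
qed (use assms in \<open>auto simp: cube_graph_def\<close>)

lemma finite_simple_cube_graph:
  assumes "finite V" "V \<subseteq> Collect finite"
  shows "finite_simple_graph (cube_graph V)"
  unfolding finite_simple_graph_def
proof (intro conjI ballI)
  fix e assume "e \<in> edges (cube_graph V)"
  then obtain u v where uv: "u \<in> V" "v \<in> V" "cube_adj u v" "e = {set_encode u, set_encode v}"
    by (auto simp: cube_graph_def)
  then show "e \<subseteq> verts (cube_graph V)" by (auto simp: cube_graph_def)
  have "set_encode u \<noteq> set_encode v"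
    using inj_onD[OF inj_set_encode[OF assms(2)]] uv cube_adj_irrefl by blast
  then show "card e = 2" using uv(4) by simp
qed (use assms in \<open>auto simp: cube_graph_def\<close>)

lemma induced_cube_graph:
  assumes V: "V \<subseteq> Collect finite" and W: "W \<subseteq> V"
  shows "induced_subgraph (cube_graph V) (set_encode ` W) = cube_graph W"
proof -
  have mem: "u \<in> W" if "u \<in> V" "set_encode u \<in> set_encode ` W" for u
    using that inj_on_image_mem_iff[OF inj_set_encode[OF V]] W by blast
  have "{e \<in> edges (cube_graph V). e \<subseteq> set_encode ` W} = edges (cube_graph W)"
  proof (intro equalityI subsetI)
    fix e assume "e \<in> {e \<in> edges (cube_graph V). e \<subseteq> set_encode ` W}"
    then obtain u v where "u \<in> V" "v \<in> V" "cube_adj u v" "e = {set_encode u, set_encode v}"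
      "e \<subseteq> set_encode ` W" by (auto simp: cube_graph_def)
    moreover from this have "u \<in> W" "v \<in> W" using mem by auto
    ultimately show "e \<in> edges (cube_graph W)" by (auto simp: cube_graph_def)
  qed (use W in \<open>auto simp: cube_graph_def\<close>)
  then show ?thesis by (simp add: induced_subgraph_def cube_graph_def)
qed

lemma sep_V_cube_graph_le:
  assumes V: "V \<subseteq> Collect finite" and S: "balanced_sep cube_adj V S"
  shows "sep_V (cube_graph V) \<le> card S"
proof -
  obtain A B where SV: "S \<subseteq> V" and AB: "A \<union> B = V - S" "A \<inter> B = {}" "3 * card A \<le> 2 * card V"
    "3 * card B \<le> 2 * card V" "\<forall>a\<in>A. \<forall>b\<in>B. \<not> cube_adj a b"
    using S unfolding balanced_sep_def by blast
  have inj: "inj_on set_encode V" by (rule inj_set_encode[OF V])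
  have sub: "A \<subseteq> V" "B \<subseteq> V" using AB(1) by auto
  have cards: "card (set_encode ` X) = card X" if "X \<subseteq> V" for X
    using card_image inj_on_subset[OF inj that] by blast
  have verts: "verts (cube_graph V) = set_encode ` V" by (simp add: cube_graph_def)
  have "vertex_separator (cube_graph V) (set_encode ` S)"
    unfolding vertex_separator_def verts
  proof (rule conjI, use SV in blast, rule exI[of _ "set_encode ` A"], rule exI[of _ "set_encode ` B"], intro conjI ballI)
    show "set_encode ` A \<union> set_encode ` B = set_encode ` V - set_encode ` S"
      using AB(1) inj_on_image_set_diff[OF inj, of V S] SV by (simp add: image_Un[symmetric])
    show "set_encode ` A \<inter> set_encode ` B = {}"
      using AB(2) inj_on_image_Int[OF inj sub] by simp
    show "real (card (set_encode ` A)) \<le> 2 / 3 * real (card (set_encode ` V))"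
      using AB(3) cards[OF sub(1)] cards[of V] by simp
    show "real (card (set_encode ` B)) \<le> 2 / 3 * real (card (set_encode ` V))"
      using AB(4) cards[OF sub(2)] cards[of V] by simp
    fix a b assume "a \<in> set_encode ` A" "b \<in> set_encode ` B"
    then obtain u v where "u \<in> A" "v \<in> B" "a = set_encode u" "b = set_encode v" by blast
    then show "{a, b} \<notin> edges (cube_graph V)"
      using cube_graph_edge_iff[OF V, of u v] AB(5) sub by blast
  qed
  then show ?thesis
    unfolding sep_V_def using cards[OF SV] by (intro Least_le) blast
qed

text \<open>A vertex with a direction that stays in \<open>V\<close> yields an edge with a marked
  end; this map is injective, and every edge has two ends.\<close>

lemma degree_sum_le_edges:
  assumes V: "V \<subseteq> Pow {..<d}"
  shows "(\<Sum>u\<in>V. cube_deg d V u) \<le> 2 * card (edges (cube_graph V))"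
proof -
  have fin: "finite V" and V': "V \<subseteq> Collect finite" using V finite_subset by auto
  have simple: "finite_simple_graph (cube_graph V)" by (rule finite_simple_cube_graph[OF fin V'])
  let ?P = "SIGMA u:V. {i \<in> {..<d}. flip i u \<in> V}"
  let ?Q = "SIGMA e:edges (cube_graph V). e"
  let ?f = "\<lambda>(u, i). ({set_encode u, set_encode (flip i u)}, set_encode u)"
  have E: "finite (edges (cube_graph V))"
    by (rule finite_subset[of _ "Pow (verts (cube_graph V))"])
      (use simple in \<open>auto simp: finite_simple_graph_def\<close>)
  have "inj_on ?f ?P"
  proof (rule inj_onI)
    fix x y assume xy: "x \<in> ?P" "y \<in> ?P" "?f x = ?f y"
    then obtain u i v j where ui: "x = (u, i)" "y = (v, j)" "u \<in> V" "v \<in> V" "flip i u \<in> V" "flip j v \<in> V" by auto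
    then have "u = v" using xy(3) inj_onD[OF inj_set_encode[OF V']] by auto
    then have "set_encode (flip i u) = set_encode (flip j u)"
      using xy(3) ui by (auto simp: doubleton_eq_iff)
    then have "flip i u = flip j u" using ui \<open>u = v\<close> inj_onD[OF inj_set_encode[OF V']] by auto
    then show "x = y" using ui \<open>u = v\<close> by (simp add: flip_eq_iff)
  qed
  moreover have "?f ` ?P \<subseteq> ?Q"
  proof (rule image_subsetI)
    fix x assume "x \<in> ?P"
    then obtain u i where ui: "x = (u, i)" "u \<in> V" "flip i u \<in> V" by auto
    then have "cube_adj u (flip i u)" using V' by (auto simp: cube_adj_def)
    then have "{set_encode u, set_encode (flip i u)} \<in> edges (cube_graph V)"
      using cube_graph_edge_iff[OF V' ui(2,3)] by simp
    then show "?f x \<in> ?Q" using ui(1) by simp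
  qed
  moreover have "finite ?Q" using E simple by (auto simp: finite_simple_graph_def card_ge_0_finite)
  ultimately have "card ?P \<le> card ?Q" by (rule card_inj_on_le)
  moreover have "card ?P = (\<Sum>u\<in>V. cube_deg d V u)" using fin by (intro card_SigmaI) auto
  moreover have "card ?Q = (\<Sum>e\<in>edges (cube_graph V). card e)"
    using E simple by (intro card_SigmaI) (auto simp: finite_simple_graph_def card_ge_0_finite)
  moreover have "\<dots> = (\<Sum>e\<in>edges (cube_graph V). 2)"
    using simple by (intro sum.cong) (auto simp: finite_simple_graph_def)
  ultimately show ?thesis by (simp add: mult.commute)
qed

text \<open>\<open>R = 2 ^ (2 * s)\<close> gives the girth used for \<open>log 2 m\<close> up to
  \<open>2 ^ s\<close>. The dimension \<open>2 ^ (8 * s)\<close> beats the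
  \<open>R ^ 3 = 2 ^ (6 * s)\<close> that \<open>sparse_cube_subset\<close> asks for, while its
  logarithm stays of order \<open>s\<close>.\<close>

lemma dense_cube_subgraph:
  assumes K: "K \<ge> 1"
  shows "\<exists>V. finite V \<and> V \<subseteq> Collect finite \<and> K * card V < card (edges (cube_graph V)) \<and>
    (\<forall>W\<subseteq>V. card W \<ge> 4 \<longrightarrow> real (sep_V (cube_graph W)) \<le> sep_bound (card W))"
proof -
  define s where "s = 2304 * K"
  \<comment> \<open>Everything is bounded by powers of two, and the exponents satisfy
    \<open>16 + 3 * K + 6 * s < 8 * s\<close>.\<close>
  have "K < 2 ^ K" by (rule less_exp)
  then have "(8 * K) ^ 3 \<le> (8 * 2 ^ K) ^ 3" by (intro power_mono) auto
  also have "\<dots> = 2 ^ (9 + 3 * K)" by (simp add: power_mult_distrib power_mult[symmetric] power_add mult.commute)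
  finally have "128 * (8 * K) ^ 3 * (2 ^ (2 * s)) ^ 3 \<le> 2 ^ 7 * 2 ^ (9 + 3 * K) * (2 ^ (2 * s)) ^ 3"
    by (intro mult_le_mono) auto
  also have "\<dots> = 2 ^ (16 + 3 * K + 6 * s)" by (simp add: power_mult[symmetric] power_add mult.commute)
  also have "\<dots> < 2 ^ (8 * s)" using K by (intro power_strict_increasing) (auto simp: s_def)
  finally have "128 * (8 * K) ^ 3 * (2 ^ (2 * s)) ^ 3 < 2 ^ (8 * s)" .
  then obtain V where V: "V \<subseteq> Pow {..<2 ^ (8 * s)}" "no_short_cycle cube_adj V (2 * 2 ^ (2 * s))"
    "\<forall>u\<in>V. cube_deg (2 ^ (8 * s)) V u \<le> 32 * K" "2 * K * card V < (\<Sum>u\<in>V. cube_deg (2 ^ (8 * s)) V u)"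
    using sparse_cube_subset[OF K, of "2 ^ (2 * s)" "2 ^ (8 * s)"] by auto
  have fin: "finite V" "V \<subseteq> Collect finite" using V(1) finite_subset by auto
  have "K * card V < card (edges (cube_graph V))" using degree_sum_le_edges[OF V(1)] V(4) by simp
  moreover have "real (sep_V (cube_graph W)) \<le> sep_bound (card W)" if W: "W \<subseteq> V" "card W \<ge> 4" for W
  proof -
    obtain S where S: "balanced_sep cube_adj W S" "real (card S) \<le> sep_bound (card W)"
      using cube_sep_bound[OF K s_def V(1-3) W] by blast
    have "sep_V (cube_graph W) \<le> card S" using W fin S(1) by (intro sep_V_cube_graph_le) auto
    then show ?thesis using S(2) by linarith
  qed
  ultimately show ?thesis using fin by blast
qed

theorem corollary2p1:
  "\<exists>F :: nat graph set.
     (\<forall>G\<in>F. finite_simple_graph G) \<and>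
     hereditary F \<and>
     (\<forall>n\<ge>4. \<forall>G\<in>F. card (verts G) = n \<longrightarrow> real (sep_V G) \<le> sep_bound n) \<and>
     \<not> (\<exists>C>0::real. \<forall>n. \<forall>G\<in>F. card (verts G) = n \<longrightarrow> real (card (edges G)) \<le> C * real n)"
proof -
  obtain V where V: "\<And>K. K \<ge> 1 \<Longrightarrow> finite (V K) \<and> V K \<subseteq> Collect finite \<and>
      K * card (V K) < card (edges (cube_graph (V K))) \<and>
      (\<forall>W\<subseteq>V K. card W \<ge> 4 \<longrightarrow> real (sep_V (cube_graph W)) \<le> sep_bound (card W))"
    using dense_cube_subgraph by metis
  \<comment> \<open>All induced subgraphs of one dense graph for each \<open>K\<close>: closed under
    induced subgraphs by construction, and of unbounded density.\<close>
  define F where "F = {cube_graph W |K W. K \<ge> (1::nat) \<and> W \<subseteq> V K}"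
  have card_verts: "card (verts (cube_graph W)) = card W" if "K \<ge> 1" "W \<subseteq> V K" for K W
  proof -
    have "W \<subseteq> Collect finite" using V[OF that(1)] that(2) by blast
    then show ?thesis by (simp add: cube_graph_def card_image inj_set_encode)
  qed
  show ?thesis
  proof (intro exI[of _ F] conjI)
    show "\<forall>G\<in>F. finite_simple_graph G"
    proof
      fix G assume "G \<in> F"
      then obtain K W where G: "G = cube_graph W" "K \<ge> 1" "W \<subseteq> V K" by (auto simp: F_def)
      then have "finite W" "W \<subseteq> Collect finite" using V[OF G(2)] finite_subset by auto
      then show "finite_simple_graph G" unfolding G(1) by (rule finite_simple_cube_graph)
    qed
    show "hereditary F" unfolding hereditary_def
    proof (intro ballI allI impI)
      fix G X assume "G \<in> F" "X \<subseteq> verts G"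
      then obtain K W where G: "G = cube_graph W" "K \<ge> 1" "W \<subseteq> V K" by (auto simp: F_def)
      then have "X \<subseteq> set_encode ` W" using \<open>X \<subseteq> verts G\<close> by (simp add: cube_graph_def)
      then obtain Y where Y: "Y \<subseteq> W" "X = set_encode ` Y" by (meson subset_imageE)
      have "W \<subseteq> Collect finite" using V[OF G(2)] G(3) by auto
      then have "induced_subgraph G X = cube_graph Y" unfolding G(1) Y(2) using Y(1) by (rule induced_cube_graph)
      moreover have "Y \<subseteq> V K" using Y(1) G(3) by blast
      ultimately show "induced_subgraph G X \<in> F" using G(2) by (auto simp: F_def)
    qed
    show "\<forall>n\<ge>4. \<forall>G\<in>F. card (verts G) = n \<longrightarrow> real (sep_V G) \<le> sep_bound n"
    proof (intro allI impI ballI)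
      fix n G assume n: "4 \<le> n" "card (verts G) = n" and "G \<in> F"
      then obtain K W where G: "G = cube_graph W" "K \<ge> 1" "W \<subseteq> V K" by (auto simp: F_def)
      then have "card W = n" using n(2) card_verts by metis
      then show "real (sep_V G) \<le> sep_bound n" using V[OF G(2)] G(1,3) n(1) by blast
    qed
    show "\<not> (\<exists>C>0::real. \<forall>n. \<forall>G\<in>F. card (verts G) = n \<longrightarrow> real (card (edges G)) \<le> C * real n)"
    proof
      assume "\<exists>C>0::real. \<forall>n. \<forall>G\<in>F. card (verts G) = n \<longrightarrow> real (card (edges G)) \<le> C * real n"
      then obtain C :: real where C: "C > 0" "\<And>G. G \<in> F \<Longrightarrow> real (card (edges G)) \<le> C * real (card (verts G))"
        by blast
      \<comment> \<open>The dense graph for any \<open>K \<ge> C\<close> violates the bound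
        \<open>C\<close>.\<close>
      define K where "K = nat \<lceil>C\<rceil>"
      have K: "K \<ge> 1" "C \<le> real K" using C(1) by (auto simp: K_def le_nat_iff) 
      have "cube_graph (V K) \<in> F" using K(1) by (auto simp: F_def)
      then have "real (card (edges (cube_graph (V K)))) \<le> C * real (card (V K))"
        using C(2) card_verts[OF K(1) order_refl] by metis
      also have "\<dots> \<le> real K * real (card (V K))" using K(2) by (intro mult_right_mono) auto
      finally have "card (edges (cube_graph (V K))) \<le> K * card (V K)" by (metis of_nat_le_iff of_nat_mult)
      then show False using V[OF K(1)] by linarith
    qed
  qed
qed

end
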